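(* For $2\le t\le 5$, $R^4(BK_t,BK_t)=t+2$, and for every integer $t\ge 6$, $R^4(BK_t,BK_t)=t+1$.
   Context: For a graph $G=(V,E)$ and an integer $r\ge 2$, $BG$ (the set of Berge copies of $G$) is the set of $r$-uniform hypergraphs $\mathcal{H}'$ for which there exist an injection $\phi: V\to V(\mathcal{H}')$ and a bijection $\psi: E\to E(\mathcal{H}')$ such that $\{\phi(u),\phi(v)\}\subseteq \psi(uv)$ for every edge $uv\in E$. $K_n$ denotes the complete graph on $n$ vertices. For collections $\mathcal{F}_1,\mathcal{F}_2$ of $r$-uniform hypergraphs, $R^r(\mathcal{F}_1,\mathcal{F}_2)$ is the least $N$ such that every 2-coloring of the hyperedges of the complete $r$-uniform hypergraph on $N$ vertices contains a subhypergraph of the first color isomorphic to a member of $\mathcal{F}_1$ or one of the second color isomorphic to a member of $\mathcal{F}_2$. Here $r=4$. *)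

theory Defs
  imports Main "HOL-Library.Extended_Nat"
begin

record 'a hypergraph =
  verts :: "'a set"
  edges :: "'a set set"

definition uniform_hypergraph :: "nat \<Rightarrow> 'a hypergraph \<Rightarrow> bool" where
  "uniform_hypergraph r H \<longleftrightarrow>
     finite (verts H) \<and> (\<forall>e\<in>edges H. e \<subseteq> verts H \<and> card e = r)"

definition complete_hypergraph :: "nat \<Rightarrow> nat \<Rightarrow> nat hypergraph" where
  "complete_hypergraph r n = \<lparr>verts = {..<n}, edges = {e. e \<subseteq> {..<n} \<and> card e = r}\<rparr>"

text \<open>A simple graph is a 2-uniform hypergraph: the edge \<open>uv\<close> is the set \<open>{u, v}\<close>.\<close>

abbreviation complete_graph :: "nat \<Rightarrow> nat hypergraph" where
  "complete_graph n \<equiv> complete_hypergraph 2 n"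

definition berge :: "nat \<Rightarrow> 'a hypergraph \<Rightarrow> 'b hypergraph set" where
  "berge r G = {H. uniform_hypergraph r H \<and>
     (\<exists>\<phi> \<psi>. inj_on \<phi> (verts G) \<and> \<phi> ` verts G \<subseteq> verts H \<and>
            bij_betw \<psi> (edges G) (edges H) \<and>
            (\<forall>u v. {u, v} \<in> edges G \<longrightarrow> {\<phi> u, \<phi> v} \<subseteq> \<psi> {u, v}))}"

definition subhypergraph :: "'a hypergraph \<Rightarrow> 'a hypergraph \<Rightarrow> bool" where
  "subhypergraph H' H \<longleftrightarrow>
     verts H' \<subseteq> verts H \<and> edges H' \<subseteq> edges H \<and> (\<forall>e\<in>edges H'. e \<subseteq> verts H')"

definition hypergraph_iso :: "'a hypergraph \<Rightarrow> 'b hypergraph \<Rightarrow> bool" where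
  "hypergraph_iso H H' \<longleftrightarrow>
     (\<exists>f. bij_betw f (verts H) (verts H') \<and> edges H' = (\<lambda>e. f ` e) ` edges H)"

text \<open>A 2-coloring is a function to \<^typ>\<open>bool\<close>, of which only the values on the hyperedges of the
  complete hypergraph matter; \<^const>\<open>True\<close> is the first color and \<^const>\<open>False\<close> the second.\<close>

definition has_colored_copy ::
  "nat \<Rightarrow> nat \<Rightarrow> (nat set \<Rightarrow> bool) \<Rightarrow> bool \<Rightarrow> 'a hypergraph set \<Rightarrow> bool" where
  "has_colored_copy r N c b \<F> \<longleftrightarrow>
     (\<exists>H'. subhypergraph H' (complete_hypergraph r N) \<and> (\<forall>e\<in>edges H'. c e = b) \<and>
           (\<exists>H\<in>\<F>. hypergraph_iso H' H))"

text \<open>The infimum in \<^typ>\<open>enat\<close> is the least element of a nonempty set and \<^term>\<open>\<infinity>\<close> for the empty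
  set, so a finite value includes the claim that some \<open>N\<close> has the Ramsey property.\<close>

definition ramsey_number :: "nat \<Rightarrow> 'a hypergraph set \<Rightarrow> 'b hypergraph set \<Rightarrow> enat" where
  "ramsey_number r \<F>\<^sub>1 \<F>\<^sub>2 =
     Inf {enat N | N. \<forall>c. has_colored_copy r N c True \<F>\<^sub>1 \<or> has_colored_copy r N c False \<F>\<^sub>2}"

text \<open>Members of a Berge family are finite, so vertices in \<^typ>\<open>nat\<close> cover all of them up to
  isomorphism.\<close>

abbreviation BK :: "nat \<Rightarrow> nat \<Rightarrow> nat hypergraph set" where
  "BK r t \<equiv> berge r (complete_graph t)"

end

theory Submission
  imports Defs "HOL-Library.Ramsey"
begin

text \<open>
  By Hall's theorem, the hyperedges of one color contain a Berge clique with a given core unless some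
  set \<open>S\<close> of core pairs is deficient: fewer than \<open>|S|\<close> hyperedges of that color contain a member of \<open>S\<close>.

  For \<open>t = 6\<close> and seven vertices, the majority color has at least 18 of the 35 quadruples. Since at
  least \<open>17 + |S|\<close> quadruples contain a member of \<open>S\<close> when \<open>S\<close> has two disjoint pairs, and 22 when \<open>S\<close>
  is a triangle, every deficient set is a star. If no core works, a star occurs off every vertex, and
  two of them with different centers leave room only for single pairs. The pairs that lie in no
  quadruple of the majority color thus have no common vertex; but they intersect pairwise, hence form a
  triangle, whose pairs again lie in too many quadruples. The case \<open>t = 4\<close> is similar, and for \<open>t = 5\<close> there
  are seven vertices, which suffice even for \<open>t = 6\<close>.

  For the step from \<open>t\<close> to \<open>t + 1\<close>, delete a vertex \<open>v\<close> and take a monochromatic Berge clique on the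
  remaining vertices. If it does not extend to \<open>v\<close>, then a star centered at \<open>v\<close> is deficient in its
  color. Deficient stars of different colors at different centers \<open>v\<close> and \<open>w\<close> compete for the quadruples
  through \<open>v\<close> and \<open>w\<close>, which is possible only if one of them is a single pair \<open>{v, x}\<close> and the other one
  has all but one of the possible leaves. Then the first color contains all quadruples through \<open>w\<close> that do
  not contain \<open>{v, x}\<close>, and these already suffice for a clique that avoids \<open>v\<close>. If all deficient stars have
  the same color, then every pair lies in so many quadruples of the other color that this color wins.

  For the lower bounds, color a quadruple by whether it contains a fixed pair.
\<close>

section \<open>Systems of distinct representatives\<close>

definition has_sdr :: "'i set \<Rightarrow> ('i \<Rightarrow> 'a set) \<Rightarrow> bool" where
  "has_sdr I A \<longleftrightarrow> (\<exists>f. inj_on f I \<and> (\<forall>i\<in>I. f i \<in> A i))"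

lemma has_sdrI: "inj_on f I \<Longrightarrow> (\<And>i. i \<in> I \<Longrightarrow> f i \<in> A i) \<Longrightarrow> has_sdr I A"
  unfolding has_sdr_def by blast

lemma has_sdrE:
  assumes "has_sdr I A"
  obtains f where "inj_on f I" "\<And>i. i \<in> I \<Longrightarrow> f i \<in> A i"
  using assms unfolding has_sdr_def by blast

lemma has_sdr_mono:
  assumes "has_sdr I A" "J \<subseteq> I" "\<And>j. j \<in> J \<Longrightarrow> A j \<subseteq> B j"
  shows "has_sdr J B"
  using assms unfolding has_sdr_def by (meson inj_on_subset subsetD)

lemma has_sdr_reindex:
  assumes "inj_on h I" "has_sdr I (\<lambda>i. A (h i))"
  shows "has_sdr (h ` I) A"
proof -
  obtain f where "inj_on f I" "\<And>i. i \<in> I \<Longrightarrow> f i \<in> A (h i)" using assms(2) by (rule has_sdrE) blast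
  with assms(1) show ?thesis
    by (intro has_sdrI[of "f \<circ> inv_into I h"]) (auto simp: inj_on_def)
qed

lemma has_sdr_Un:
  assumes "has_sdr I (\<lambda>i. A i \<inter> B)" "has_sdr J (\<lambda>j. A j - B)"
  shows "has_sdr (I \<union> J) A"
proof -
  obtain f where f: "inj_on f I" "\<And>i. i \<in> I \<Longrightarrow> f i \<in> A i \<inter> B" using assms(1) by (rule has_sdrE) blast
  obtain g where g: "inj_on g J" "\<And>j. j \<in> J \<Longrightarrow> g j \<in> A j - B" using assms(2) by (rule has_sdrE) blast
  have "f i \<noteq> g j" if "i \<in> I" "j \<in> J" for i j using f(2)[of i] g(2)[of j] that by auto
  then have "inj_on (\<lambda>i. if i \<in> I then f i else g i) (I \<union> J)"
    using f(1) g(1) unfolding inj_on_def by (metis Un_iff)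
  then show ?thesis by (rule has_sdrI) (use f(2) g(2) in auto)
qed

definition hall_condition :: "'i set \<Rightarrow> ('i \<Rightarrow> 'a set) \<Rightarrow> bool" where
  "hall_condition I A \<longleftrightarrow> (\<forall>J\<subseteq>I. card J \<le> card (\<Union>(A ` J)))"

lemma hall_conditionI: "(\<And>J. J \<subseteq> I \<Longrightarrow> card J \<le> card (\<Union>(A ` J))) \<Longrightarrow> hall_condition I A"
  unfolding hall_condition_def by blast

lemma hall_conditionD: "hall_condition I A \<Longrightarrow> J \<subseteq> I \<Longrightarrow> card J \<le> card (\<Union>(A ` J))"
  unfolding hall_condition_def by blast

lemma hall_condition_Diff_singleton:
  assumes "i \<in> I" and slack: "\<And>J. J \<subset> I \<Longrightarrow> J \<noteq> {} \<Longrightarrow> card J < card (\<Union>(A ` J))"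
  shows "hall_condition (I - {i}) (\<lambda>j. A j - {x})"
proof (rule hall_conditionI)
  fix J assume J: "J \<subseteq> I - {i}"
  show "card J \<le> card (\<Union>j\<in>J. A j - {x})"
  proof (cases "J = {}")
    case False
    then have "card J < card (\<Union>(A ` J))" using slack[of J] J \<open>i \<in> I\<close> by blast
    also have "card (\<Union>(A ` J)) \<le> Suc (card (\<Union>(A ` J) - {x}))"
      by (auto simp: card_Diff_singleton_if)
    finally show ?thesis by (simp add: Diff_eq)
  qed simp
qed

lemma hall_condition_Diff_critical:
  assumes fin: "finite I" "\<And>i. i \<in> I \<Longrightarrow> finite (A i)" and hall: "hall_condition I A"
    and critical: "J \<subseteq> I" "card (\<Union>(A ` J)) = card J"
  shows "hall_condition (I - J) (\<lambda>i. A i - \<Union>(A ` J))"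
proof (rule hall_conditionI)
  let ?B = "\<Union>(A ` J)"
  fix L assume L: "L \<subseteq> I - J"
  have finJ: "finite J" "finite ?B" using critical(1) fin finite_subset by blast+
  have finL: "finite L" "finite (\<Union>l\<in>L. A l - ?B)" using L fin finite_subset by blast+
  have "card L + card J = card (L \<union> J)"
    using L finL finJ by (intro card_Un_disjoint[symmetric]) auto
  also have "\<dots> \<le> card (\<Union>(A ` (L \<union> J)))"
    using hall L critical(1) by (intro hall_conditionD[of I]) auto
  also have "\<Union>(A ` (L \<union> J)) = (\<Union>l\<in>L. A l - ?B) \<union> ?B" by blast
  also have "card \<dots> = card (\<Union>l\<in>L. A l - ?B) + card ?B"
    using finL finJ by (intro card_Un_disjoint) auto
  finally show "card L \<le> card (\<Union>l\<in>L. A l - ?B)" using critical(2) by simp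
qed

theorem hall_marriage:
  assumes "finite I" "\<And>i. i \<in> I \<Longrightarrow> finite (A i)" "hall_condition I A"
  shows "has_sdr I A"
  using assms
proof (induction "card I" arbitrary: I A rule: less_induct)
  case less
  note fin = less.prems(1,2) and hall = less.prems(3)
  consider (empty) "I = {}"
    | (slack) "I \<noteq> {}" "\<And>J. J \<subset> I \<Longrightarrow> J \<noteq> {} \<Longrightarrow> card J < card (\<Union>(A ` J))"
    | (critical) J where "J \<subset> I" "J \<noteq> {}" "card (\<Union>(A ` J)) = card J"
    using hall_conditionD[OF hall] by (metis le_eq_less_or_eq psubset_imp_subset)
  then show ?case
  proof cases
    case empty
    then show ?thesis by (simp add: has_sdr_def)
  next
    case slack
    then obtain i where i: "i \<in> I" by blast
    then have "A i \<noteq> {}" using hall_conditionD[OF hall, of "{i}"] by auto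
    then obtain x where "x \<in> A i" by blast
    then have "has_sdr {i} (\<lambda>i. A i \<inter> {x})" by (intro has_sdrI[of "\<lambda>_. x"]) auto
    moreover have "has_sdr (I - {i}) (\<lambda>j. A j - {x})"
      using i slack(2) fin by (intro less.hyps hall_condition_Diff_singleton card_Diff1_less) auto
    ultimately have "has_sdr ({i} \<union> (I - {i})) A" by (rule has_sdr_Un)
    then show ?thesis using i by (simp add: insert_absorb)
  next
    case (critical J)
    let ?B = "\<Union>(A ` J)"
    have "hall_condition J A" using hall critical(1) unfolding hall_condition_def by blast
    moreover have "card J < card I" using critical(1) fin(1) by (simp add: psubset_card_mono)
    ultimately have "has_sdr J A"
      using critical(1) fin finite_subset[of J I] by (intro less.hyps) auto
    then have "has_sdr J (\<lambda>j. A j \<inter> ?B)" by (rule has_sdr_mono) auto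
    moreover have "has_sdr (I - J) (\<lambda>j. A j - ?B)"
    proof (rule less.hyps)
      show "card (I - J) < card I" using fin(1) critical(1,2) by (intro psubset_card_mono) auto
      show "hall_condition (I - J) (\<lambda>j. A j - ?B)"
        using fin hall critical by (intro hall_condition_Diff_critical) auto
    qed (use fin in auto)
    ultimately have "has_sdr (J \<union> (I - J)) A" by (rule has_sdr_Un)
    then show ?thesis using critical(1) by (simp add: Un_absorb1 psubset_imp_subset)
  qed
qed

lemma has_sdr_if_weights:
  fixes w :: "'a \<Rightarrow> nat"
  assumes fin: "finite I" "\<And>i. i \<in> I \<Longrightarrow> finite (A i)" and "0 < d"
    and total: "\<And>i. i \<in> I \<Longrightarrow> d \<le> (\<Sum>a\<in>A i. w a)"
    and load: "\<And>a. a \<in> \<Union>(A ` I) \<Longrightarrow> w a * card {i \<in> I. a \<in> A i} \<le> d"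
  shows "has_sdr I A"
proof (intro hall_marriage hall_conditionI)
  fix J assume J: "J \<subseteq> I"
  let ?U = "\<Union>(A ` J)"
  have finJ: "finite J" "finite ?U" using J fin finite_subset by blast+
  have "d * card J = (\<Sum>i\<in>J. d)" by simp
  also have "\<dots> \<le> (\<Sum>i\<in>J. \<Sum>a\<in>A i. w a)" using total J by (intro sum_mono) auto
  also have "\<dots> = (\<Sum>i\<in>J. \<Sum>a\<in>{a \<in> ?U. a \<in> A i}. w a)" by (intro sum.cong) auto
  also have "\<dots> = (\<Sum>a\<in>?U. \<Sum>i\<in>{i \<in> J. a \<in> A i}. w a)" using finJ by (rule sum.swap_restrict)
  also have "\<dots> \<le> (\<Sum>a\<in>?U. d)"
  proof (rule sum_mono)
    fix a assume a: "a \<in> ?U"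
    have "card {i \<in> J. a \<in> A i} \<le> card {i \<in> I. a \<in> A i}" using J fin(1) by (intro card_mono) auto
    then have "w a * card {i \<in> J. a \<in> A i} \<le> w a * card {i \<in> I. a \<in> A i}" by simp
    also have "\<dots> \<le> d" using a J by (intro load) auto
    finally show "(\<Sum>i\<in>{i \<in> J. a \<in> A i}. w a) \<le> d" by (simp add: mult.commute)
  qed
  also have "\<dots> = d * card ?U" by simp
  finally show "card J \<le> card ?U" using \<open>0 < d\<close> by simp
qed (use fin in auto)

section \<open>Berge copies with a prescribed core\<close>

definition containing :: "'a set set \<Rightarrow> 'a set \<Rightarrow> 'a set set" where
  "containing F p = {A \<in> F. p \<subseteq> A}"

definition covering :: "'a set set \<Rightarrow> 'a set set \<Rightarrow> 'a set set" where
  "covering F S = {A \<in> F. \<exists>p\<in>S. p \<subseteq> A}"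

definition deficient :: "'a set set \<Rightarrow> 'a set set \<Rightarrow> bool" where
  "deficient F S \<longleftrightarrow> card (covering F S) < card S"

text \<open>The graph with edge set \<open>P\<close> is embedded by the identity.\<close>

definition berge_copy :: "'a set set \<Rightarrow> 'a set set \<Rightarrow> bool" where
  "berge_copy F P \<longleftrightarrow> has_sdr P (containing F)"

definition has_berge_clique :: "'a set set \<Rightarrow> 'a set \<Rightarrow> nat \<Rightarrow> bool" where
  "has_berge_clique F V t \<longleftrightarrow> (\<exists>C\<in>[V]\<^bsup>t\<^esup>. berge_copy F ([C]\<^bsup>2\<^esup>))"

definition star :: "'a \<Rightarrow> 'a set \<Rightarrow> 'a set set" where
  "star v X = (\<lambda>x. {v, x}) ` X"

declare finite_imp_finite_nsets [simp]

lemma finite_subset_nsets: "finite V \<Longrightarrow> F \<subseteq> [V]\<^bsup>k\<^esup> \<Longrightarrow> finite F"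
  by (blast intro: finite_subset finite_imp_finite_nsets)

lemma finite_containing [simp]: "finite F \<Longrightarrow> finite (containing F p)"
  unfolding containing_def by simp

lemma finite_covering [simp]: "finite F \<Longrightarrow> finite (covering F S)"
  unfolding covering_def by simp

lemma covering_mono: "F \<subseteq> G \<Longrightarrow> S \<subseteq> T \<Longrightarrow> covering F S \<subseteq> covering G T"
  unfolding covering_def by blast

lemma covering_singleton: "covering F {p} = containing F p"
  unfolding covering_def containing_def by simp

lemma covering_star: "covering F (star v X) = {A \<in> F. v \<in> A \<and> A \<inter> X \<noteq> {}}"
  unfolding covering_def star_def by auto

lemma card_star [simp]: "card (star v X) = card X"
  unfolding star_def by (intro card_image) (auto simp: inj_on_def doubleton_eq_iff)

lemma finite_star [simp]: "finite X \<Longrightarrow> finite (star v X)"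
  unfolding star_def by simp

lemma nsets_2_insert: "v \<notin> C \<Longrightarrow> [insert v C]\<^bsup>2\<^esup> = [C]\<^bsup>2\<^esup> \<union> star v C"
  using nsets_disjoint_2[of "{v}" C] by (auto simp: star_def nsets_singleton_iff)

lemma deficient_nonempty: "deficient F S \<Longrightarrow> S \<noteq> {}"
  unfolding deficient_def by auto

lemma card_ge_1_if_deficient_star: "deficient F (star v X) \<Longrightarrow> 1 \<le> card X"
  unfolding deficient_def by simp

lemma deficient_singleton: "finite F \<Longrightarrow> deficient F {p} \<longleftrightarrow> containing F p = {}"
  unfolding deficient_def covering_singleton by simp

lemma berge_copyI:
  assumes "inj_on \<psi> P" "\<And>p. p \<in> P \<Longrightarrow> \<psi> p \<in> F" "\<And>p. p \<in> P \<Longrightarrow> p \<subseteq> \<psi> p"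
  shows "berge_copy F P"
  using assms unfolding berge_copy_def containing_def by (intro has_sdrI) auto

lemma berge_copyE:
  assumes "berge_copy F P"
  obtains \<psi> where "inj_on \<psi> P" "\<And>p. p \<in> P \<Longrightarrow> \<psi> p \<in> F" "\<And>p. p \<in> P \<Longrightarrow> p \<subseteq> \<psi> p"
  using assms unfolding berge_copy_def containing_def by (auto elim!: has_sdrE)

lemma berge_copy_mono: "berge_copy F P \<Longrightarrow> F \<subseteq> G \<Longrightarrow> Q \<subseteq> P \<Longrightarrow> berge_copy G Q"
  unfolding berge_copy_def by (erule has_sdr_mono) (auto simp: containing_def)

lemma berge_copy_Un:
  assumes "berge_copy (F \<inter> B) P" "berge_copy (F - B) Q"
  shows "berge_copy F (P \<union> Q)"
  unfolding berge_copy_def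
proof (rule has_sdr_Un)
  show "has_sdr P (\<lambda>p. containing F p \<inter> B)"
    using assms(1) unfolding berge_copy_def by (rule has_sdr_mono) (auto simp: containing_def)
  show "has_sdr Q (\<lambda>q. containing F q - B)"
    using assms(2) unfolding berge_copy_def by (rule has_sdr_mono) (auto simp: containing_def)
qed

lemma card_le_if_berge_copy: "finite F \<Longrightarrow> berge_copy F P \<Longrightarrow> card P \<le> card F"
  by (erule berge_copyE) (auto intro: card_inj_on_le)

lemma deficient_if_no_berge_copy:
  assumes "finite F" "finite P" "\<not> berge_copy F P"
  obtains S where "S \<subseteq> P" "deficient F S"
proof -
  have "\<not> hall_condition P (containing F)"
    using assms hall_marriage[of P "containing F"] unfolding berge_copy_def by auto
  then obtain S where "S \<subseteq> P" "card (\<Union>(containing F ` S)) < card S"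
    unfolding hall_condition_def by (meson not_le)
  moreover have "\<Union>(containing F ` S) = covering F S" unfolding covering_def containing_def by blast
  ultimately show thesis using that unfolding deficient_def by simp
qed

lemma has_berge_clique_if_embedding:
  assumes h: "inj_on h C" "h ` C \<subseteq> V" and C: "finite C" "card C = t"
    and \<psi>: "inj_on \<psi> ([C]\<^bsup>2\<^esup>)" "\<And>p. p \<in> [C]\<^bsup>2\<^esup> \<Longrightarrow> \<psi> p \<in> F \<and> h ` p \<subseteq> \<psi> p"
  shows "has_berge_clique F V t"
proof -
  have bij: "bij_betw (image h) ([C]\<^bsup>2\<^esup>) ([h ` C]\<^bsup>2\<^esup>)"
    using h(1) by (intro bij_betw_nsets inj_on_imp_bij_betw)
  have "has_sdr ([C]\<^bsup>2\<^esup>) (\<lambda>p. containing F (h ` p))"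
    using \<psi> by (intro has_sdrI) (simp_all add: containing_def)
  then have "has_sdr (image h ` [C]\<^bsup>2\<^esup>) (containing F)"
    using bij_betw_imp_inj_on[OF bij] by (intro has_sdr_reindex)
  then have "berge_copy F ([h ` C]\<^bsup>2\<^esup>)"
    using bij_betw_imp_surj_on[OF bij] unfolding berge_copy_def by simp
  moreover have "h ` C \<in> [V]\<^bsup>t\<^esup>" using h C by (simp add: nsets_def card_image)
  ultimately show ?thesis unfolding has_berge_clique_def by blast
qed

lemma has_berge_clique_mono:
  assumes "has_berge_clique F V t" "V \<subseteq> W" "F \<subseteq> G"
  shows "has_berge_clique G W t"
  using assms berge_copy_mono[OF _ assms(3)] nsets_mono[OF assms(2), of t]
  unfolding has_berge_clique_def by blast

lemma has_berge_clique_antimono: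
  assumes "has_berge_clique F V t" "s \<le> t"
  shows "has_berge_clique F V s"
proof -
  obtain C where C: "C \<in> [V]\<^bsup>t\<^esup>" "berge_copy F ([C]\<^bsup>2\<^esup>)"
    using assms(1) unfolding has_berge_clique_def by blast
  obtain D where D: "D \<subseteq> C" "card D = s" "finite D"
    using C(1) assms(2) obtain_subset_with_card_n[of s C] unfolding nsets_def by blast
  then have "berge_copy F ([D]\<^bsup>2\<^esup>)" using C(2) nsets_mono by (blast intro: berge_copy_mono)
  moreover have "D \<in> [V]\<^bsup>s\<^esup>" using C(1) D unfolding nsets_def by blast
  ultimately show ?thesis unfolding has_berge_clique_def by blast
qed

lemma berge_copy_if_weights:
  fixes w :: "'a set \<Rightarrow> nat"
  assumes "finite F" "finite P" "0 < d"
    and "\<And>p. p \<in> P \<Longrightarrow> d \<le> (\<Sum>A\<in>containing F p. w A)"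
    and "\<And>A. A \<in> F \<Longrightarrow> w A * card {p \<in> P. p \<subseteq> A} \<le> d"
  shows "berge_copy F P"
  unfolding berge_copy_def
proof (rule has_sdr_if_weights[where w = w])
  fix A assume "A \<in> \<Union>(containing F ` P)"
  then have "A \<in> F" unfolding containing_def by blast
  then show "w A * card {p \<in> P. A \<in> containing F p} \<le> d" using assms(5) by (simp add: containing_def)
qed (use assms in auto)

lemma berge_copy_star_if_degrees:
  assumes F: "finite V" "F \<subseteq> [V]\<^bsup>Suc k\<^esup>" and "0 < k"
    and X: "X \<subseteq> V - {v}" "\<And>x. x \<in> X \<Longrightarrow> k \<le> card (containing F {v, x})"
  shows "berge_copy F (star v X)"
proof (rule berge_copy_if_weights[where w = "\<lambda>_. 1"])
  show "finite F" using F by (rule finite_subset_nsets)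
  show "finite (star v X)" using F X(1) by (meson finite_Diff finite_star finite_subset)
  show "k \<le> (\<Sum>A\<in>containing F p. 1)" if "p \<in> star v X" for p
    using that X(2) unfolding star_def by auto
  fix A assume "A \<in> F"
  then have A: "finite A" "card A = Suc k" using F(2) unfolding nsets_def by auto
  then have "card (A - {v}) \<le> k" if "v \<in> A" using that by simp
  moreover have "{p \<in> star v X. p \<subseteq> A} \<subseteq> (if v \<in> A then star v (A - {v}) else {})"
    using X(1) unfolding star_def by auto
  then have "card {p \<in> star v X. p \<subseteq> A} \<le> (if v \<in> A then card (A - {v}) else 0)"
    using A(1) card_mono[of "if v \<in> A then star v (A - {v}) else {}"] by (cases "v \<in> A") simp_all
  ultimately show "1 * card {p \<in> star v X. p \<subseteq> A} \<le> k" by (simp split: if_splits)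
qed fact

section \<open>Counting hyperedges\<close>

lemma card_containing_filter:
  assumes "finite V" "p \<subseteq> V"
  shows "card {A \<in> containing ([V]\<^bsup>(card p + k)\<^esup>) p. Q A} = card {T \<in> [V - p]\<^bsup>k\<^esup>. Q (p \<union> T)}"
proof -
  have fin: "finite p" using assms finite_subset by blast
  have "bij_betw ((\<union>) p) {T \<in> [V - p]\<^bsup>k\<^esup>. Q (p \<union> T)} {A \<in> containing ([V]\<^bsup>(card p + k)\<^esup>) p. Q A}"
  proof (rule bij_betw_byWitness[where f' = "\<lambda>A. A - p"])
    show "(\<union>) p ` {T \<in> [V - p]\<^bsup>k\<^esup>. Q (p \<union> T)} \<subseteq> {A \<in> containing ([V]\<^bsup>(card p + k)\<^esup>) p. Q A}"
    proof (rule image_subsetI)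
      fix T assume "T \<in> {T \<in> [V - p]\<^bsup>k\<^esup>. Q (p \<union> T)}"
      then have T: "T \<in> [V - p]\<^bsup>k\<^esup>" "Q (p \<union> T)" by auto
      then have "p \<inter> T = {}" "finite T" "card T = k" unfolding nsets_def by auto
      then have "card (p \<union> T) = card p + k" using fin by (simp add: card_Un_disjoint)
      then show "p \<union> T \<in> {A \<in> containing ([V]\<^bsup>(card p + k)\<^esup>) p. Q A}"
        using T assms fin unfolding nsets_def containing_def by auto
    qed
  qed (use fin in \<open>auto simp: nsets_def containing_def card_Diff_subset Un_absorb1\<close>)
  then show ?thesis by (rule bij_betw_same_card[symmetric])
qed

lemma card_containing:
  assumes "finite V" "p \<subseteq> V" "card p \<le> k"
  shows "card (containing ([V]\<^bsup>k\<^esup>) p) = (card V - card p) choose (k - card p)"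
  using card_containing_filter[OF assms(1,2), of "k - card p" "\<lambda>_. True"] assms
  by (simp add: card_Diff_subset finite_subset[OF assms(2,1)])

lemma containing_containing: "containing (containing F p) q = containing F (p \<union> q)"
  unfolding containing_def by auto

lemma berge_copy_star_containing:
  assumes V: "finite V" "p \<subseteq> V" "v \<in> p" and X: "X \<subseteq> V - {v}" and "0 < k"
    and degree: "\<And>x. x \<in> X \<Longrightarrow> card (insert x p) \<le> Suc k \<and>
      k \<le> (card V - card (insert x p)) choose (Suc k - card (insert x p))"
  shows "berge_copy (containing ([V]\<^bsup>Suc k\<^esup>) p) (star v X)"
proof (rule berge_copy_star_if_degrees[OF V(1) _ \<open>0 < k\<close> X])
  fix x assume x: "x \<in> X"
  have "p \<union> {v, x} = insert x p" using V(3) by blast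
  then have "containing (containing ([V]\<^bsup>Suc k\<^esup>) p) {v, x} = containing ([V]\<^bsup>Suc k\<^esup>) (insert x p)"
    by (simp only: containing_containing)
  then show "k \<le> card (containing (containing ([V]\<^bsup>Suc k\<^esup>) p) {v, x})"
    using x X V degree[OF x] by (auto simp: card_containing)
qed (auto simp: containing_def)

lemma card_nsets_meeting:
  assumes "finite V" "X \<subseteq> V"
  shows "card {T \<in> [V]\<^bsup>k\<^esup>. T \<inter> X \<noteq> {}} = (card V choose k) - ((card V - card X) choose k)"
proof -
  have "{T \<in> [V]\<^bsup>k\<^esup>. T \<inter> X \<noteq> {}} = [V]\<^bsup>k\<^esup> - [V - X]\<^bsup>k\<^esup>" unfolding nsets_def by auto
  then show ?thesis
    using assms by (simp add: card_Diff_subset nsets_mono finite_subset)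
qed

lemma card_covering_star:
  assumes "finite V" "v \<in> V" "X \<subseteq> V - {v}"
  shows "card (covering ([V]\<^bsup>Suc k\<^esup>) (star v X)) =
    ((card V - 1) choose k) - ((card V - 1 - card X) choose k)"
proof -
  have "covering ([V]\<^bsup>Suc k\<^esup>) (star v X) = {A \<in> containing ([V]\<^bsup>(card {v} + k)\<^esup>) {v}. A \<inter> X \<noteq> {}}"
    unfolding covering_star containing_def by auto
  also have "card \<dots> = card {T \<in> [V - {v}]\<^bsup>k\<^esup>. T \<inter> X \<noteq> {}}"
    using assms by (subst card_containing_filter) (simp_all add: subset_Diff_insert)
  also have "\<dots> = ((card V - 1) choose k) - ((card V - 1 - card X) choose k)"
    using assms by (subst card_nsets_meeting) auto
  finally show ?thesis .
qed

lemma card_covering_two: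
  assumes "finite F"
  shows "card (covering F {p, q}) + card (containing F (p \<union> q)) =
    card (containing F p) + card (containing F q)"
proof -
  have "covering F {p, q} = containing F p \<union> containing F q"
    "containing F (p \<union> q) = containing F p \<inter> containing F q"
    unfolding covering_def containing_def by auto
  then show ?thesis
    using card_Un_Int[of "containing F p" "containing F q"] assms by simp
qed

lemma card_covering_le_subfamily:
  assumes "finite G" "F \<subseteq> G"
  shows "card (covering G S) \<le> card (covering F S) + card (G - F)"
proof -
  have "card (covering G S) \<le> card (covering F S \<union> (G - F))"
    using assms finite_subset[OF assms(2,1)] by (intro card_mono) (auto simp: covering_def)
  also have "\<dots> \<le> card (covering F S) + card (G - F)" by (rule card_Un_le)
  finally show ?thesis .
qed

lemma card_covering_le_if_uncovered:
  assumes "finite G" "F \<subseteq> G" "\<And>p. p \<in> S \<Longrightarrow> containing F p = {}"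
  shows "card (covering G S) \<le> card (G - F)"
proof -
  have "covering F S = {}" using assms(3) unfolding covering_def containing_def by blast
  then show ?thesis using card_covering_le_subfamily[OF assms(1,2), of S] by simp
qed

lemma card_covering_ge_if_berge_copy:
  assumes "finite F" "finite B" "B \<subseteq> S" "berge_copy (F - covering F B) (S - B)"
  shows "card (covering F B) + card S \<le> card (covering F S) + card B"
proof -
  obtain \<psi> where \<psi>: "inj_on \<psi> (S - B)" "\<And>p. p \<in> S - B \<Longrightarrow> \<psi> p \<in> F - covering F B"
      "\<And>p. p \<in> S - B \<Longrightarrow> p \<subseteq> \<psi> p"
    using assms(4) by (rule berge_copyE) blast
  have im: "\<psi> ` (S - B) \<subseteq> F - covering F B" using \<psi>(2) by blast
  have "card (covering F B) + card (S - B) = card (covering F B) + card (\<psi> ` (S - B))"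
    using \<psi>(1) by (simp add: card_image)
  also have "\<dots> = card (covering F B \<union> \<psi> ` (S - B))"
  proof (rule card_Un_disjoint[symmetric])
    show "finite (\<psi> ` (S - B))" using im assms(1) by (meson finite_Diff finite_subset)
  qed (use im assms(1) in auto)
  also have "\<dots> \<le> card (covering F S)"
  proof (rule card_mono)
    have "\<psi> p \<in> covering F S" if "p \<in> S - B" for p
      using that \<psi>(2,3)[of p] unfolding covering_def by auto
    then show "covering F B \<union> \<psi> ` (S - B) \<subseteq> covering F S"
      using covering_mono[OF order.refl assms(3)] by blast
  qed (use assms(1) in simp)
  finally have "card (covering F B) + card (S - B) \<le> card (covering F S)" .
  moreover have "card S - card B \<le> card (S - B)" using assms(2) by (rule diff_card_le_card_Diff)
  ultimately show ?thesis by linarith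
qed

lemma berge_copy_if_list:
  assumes "distinct (map snd L)" "\<And>p A. (p, A) \<in> set L \<Longrightarrow> A \<in> F \<and> p \<subseteq> A" "P \<subseteq> fst ` set L"
  shows "berge_copy F P"
proof -
  define \<psi> where "\<psi> = the \<circ> map_of L"
  have \<psi>: "(p, \<psi> p) \<in> set L" if "p \<in> P" for p
  proof -
    have "p \<in> dom (map_of L)" using that assms(3) by (auto simp: dom_map_of_conv_image_fst)
    then show ?thesis unfolding \<psi>_def by (auto intro: map_of_SomeD)
  qed
  have "inj_on \<psi> P"
  proof (rule inj_onI)
    fix p q assume "p \<in> P" "q \<in> P" "\<psi> p = \<psi> q"
    then have "(p, \<psi> p) = (q, \<psi> q)"
      using assms(1) \<psi>[of p] \<psi>[of q] by (intro inj_onD[of snd "set L"]) (simp_all add: distinct_map)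
    then show "p = q" by simp
  qed
  then show ?thesis by (rule berge_copyI) (use \<psi> assms(2) in blast)+
qed

section \<open>Six vertices\<close>

lemma card_covering_two_pairs_on_6_vertices:
  assumes V: "finite V" "card V = 6" and pq: "p \<in> [V]\<^bsup>2\<^esup>" "q \<in> [V]\<^bsup>2\<^esup>" "p \<noteq> q"
  shows "9 \<le> card (covering ([V]\<^bsup>4\<^esup>) {p, q})"
proof -
  have sub: "p \<subseteq> V" "card p = 2" "finite p" "q \<subseteq> V" "card q = 2" "finite q"
    using pq(1,2) unfolding nsets_def by auto
  then have "\<not> q \<subseteq> p" using pq(3) card_subset_eq[of p q] by auto
  then have "card p < card (p \<union> q)" using sub by (intro psubset_card_mono) auto
  then have "card (p \<union> q) \<in> {3, 4}" using card_Un_le[of p q] sub by auto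
  then have "card (containing ([V]\<^bsup>4\<^esup>) (p \<union> q)) \<le> 3"
    using sub V by (subst card_containing) (auto simp: numeral_eq_Suc)
  moreover have "card (containing ([V]\<^bsup>4\<^esup>) r) = 6" if "r \<in> {p, q}" for r
    using that sub V by (subst card_containing) (auto simp: numeral_eq_Suc)
  ultimately show ?thesis
    using card_covering_two[of "[V]\<^bsup>4\<^esup>" p q] V by simp
qed

lemma berge_copy_avoiding_two_pairs_on_6_vertices:
  assumes V: "finite V" "card V = 6" and C: "C \<in> [V]\<^bsup>4\<^esup>" and pq: "p \<in> [C]\<^bsup>2\<^esup>" "q \<in> [C]\<^bsup>2\<^esup>"
  shows "berge_copy ([V]\<^bsup>4\<^esup> - covering ([V]\<^bsup>4\<^esup>) {p, q}) ([C]\<^bsup>2\<^esup> - {p, q})"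
proof (rule berge_copyI)
  have core: "C \<subseteq> V" "finite C" "card (V - C) = 2" using C V by (auto simp: nsets_def card_Diff_subset)
  have pairD: "s \<subseteq> C" "finite s" "card s = 2" if "s \<in> [C]\<^bsup>2\<^esup>" for s
    using that unfolding nsets_def by auto
  show "inj_on ((\<union>) (V - C)) ([C]\<^bsup>2\<^esup> - {p, q})" using pairD(1) unfolding inj_on_def by blast
  fix s assume s: "s \<in> [C]\<^bsup>2\<^esup> - {p, q}"
  then have s_pair: "s \<subseteq> C" "finite s" "card s = 2" using pairD by blast+
  then have "card (V - C \<union> s) = 4" using core V(1) by (subst card_Un_disjoint) auto
  then have "V - C \<union> s \<in> [V]\<^bsup>4\<^esup>" using core V(1) s_pair unfolding nsets_def by auto
  moreover have "\<not> r \<subseteq> V - C \<union> s" if r: "r \<in> {p, q}" for r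
  proof
    assume sub: "r \<subseteq> V - C \<union> s"
    have r_pair: "r \<in> [C]\<^bsup>2\<^esup>" using r pq by blast
    then have "r \<subseteq> s" using sub pairD(1) by blast
    then have "r = s" using s_pair pairD(3)[OF r_pair] by (intro card_subset_eq) simp_all
    then show False using r s by blast
  qed
  ultimately show "V - C \<union> s \<in> [V]\<^bsup>4\<^esup> - covering ([V]\<^bsup>4\<^esup>) {p, q}" unfolding covering_def by blast
qed auto

lemma card_covering_ge_on_6_vertices:
  assumes V: "finite V" "card V = 6" and C: "C \<in> [V]\<^bsup>4\<^esup>"
    and S: "S \<subseteq> [C]\<^bsup>2\<^esup>" "p \<in> S" "q \<in> S" "p \<noteq> q"
  shows "7 + card S \<le> card (covering ([V]\<^bsup>4\<^esup>) S)"
proof -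
  let ?Q = "[V]\<^bsup>4\<^esup>" and ?B = "{p, q}"
  have "C \<subseteq> V" using C unfolding nsets_def by auto
  then have "[C]\<^bsup>2\<^esup> \<subseteq> [V]\<^bsup>2\<^esup>" by (rule nsets_mono)
  have pq: "p \<in> [C]\<^bsup>2\<^esup>" "q \<in> [C]\<^bsup>2\<^esup>" using S by auto
  from berge_copy_avoiding_two_pairs_on_6_vertices[OF V C pq]
  have "berge_copy (?Q - covering ?Q ?B) (S - ?B)" by (rule berge_copy_mono) (use S(1) in blast)+
  then have "card (covering ?Q ?B) + card S \<le> card (covering ?Q S) + card ?B"
    using S(2,3) V(1) by (intro card_covering_ge_if_berge_copy) simp_all
  moreover have "9 \<le> card (covering ?Q ?B)"
    using pq S(4) \<open>[C]\<^bsup>2\<^esup> \<subseteq> [V]\<^bsup>2\<^esup>\<close> by (intro card_covering_two_pairs_on_6_vertices[OF V]) blast+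
  ultimately show ?thesis using S(4) by simp
qed

lemma berge_K4_on_6_vertices:
  assumes V: "finite V" "card V = 6" and F: "F \<subseteq> [V]\<^bsup>4\<^esup>" "8 \<le> card F"
  shows "has_berge_clique F V 4"
proof (rule ccontr)
  assume no_clique: "\<not> ?thesis"
  let ?Q = "[V]\<^bsup>4\<^esup>"
  have fin: "finite ?Q" "finite F" using V(1) F(1) by (simp, rule finite_subset_nsets)
  have minority: "card (?Q - F) \<le> 7" using F fin V by (simp add: card_Diff_subset numeral_eq_Suc)
  have uncovered: "\<exists>p\<in>[W]\<^bsup>2\<^esup>. containing F p = {}" if W: "W \<subseteq> V" "4 \<le> card W" for W
  proof -
    obtain C where C: "C \<subseteq> W" "card C = 4" using W(2) by (rule obtain_subset_with_card_n)
    have "finite C" using C(1) W(1) V(1) by (meson finite_subset)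
    then have core: "C \<in> ?Q" "finite C" using C W(1) unfolding nsets_def by auto
    then have "\<not> berge_copy F ([C]\<^bsup>2\<^esup>)" using no_clique unfolding has_berge_clique_def by blast
    then obtain S where S: "S \<subseteq> [C]\<^bsup>2\<^esup>" "deficient F S"
      using core(2) by (elim deficient_if_no_berge_copy[OF fin(2), rotated]) simp_all
    have "p = q" if "p \<in> S" "q \<in> S" for p q
      using card_covering_ge_on_6_vertices[OF V core(1) S(1) that] S(2)
        card_covering_le_subfamily[OF fin(1) F(1), of S] minority
      unfolding deficient_def by linarith
    then obtain p where "S = {p}" using deficient_nonempty[OF S(2)] by blast
    then show ?thesis using S fin(2) nsets_mono[OF C(1)] by (auto simp: deficient_singleton)
  qed
  obtain p where p: "p \<in> [V]\<^bsup>2\<^esup>" "containing F p = {}" using uncovered[of V] V by auto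
  then obtain a where a: "a \<in> p" "a \<in> V" by (auto elim!: nsets2_E)
  obtain q where q: "q \<in> [V - {a}]\<^bsup>2\<^esup>" "containing F q = {}" using uncovered[of "V - {a}"] V a by auto
  have "q \<in> [V]\<^bsup>2\<^esup>" "p \<noteq> q" using q(1) a unfolding nsets_def by auto
  then have "9 \<le> card (covering ?Q {p, q})" using p(1) by (intro card_covering_two_pairs_on_6_vertices[OF V])
  moreover have "card (covering ?Q {p, q}) \<le> card (?Q - F)"
    using p(2) q(2) by (intro card_covering_le_if_uncovered[OF fin(1) F(1)]) auto
  ultimately show False using minority by linarith
qed

section \<open>Seven vertices\<close>

lemma card_covering_disjoint_pairs_on_7_vertices:
  assumes V: "finite V" "card V = 7" and pq: "p \<in> [V]\<^bsup>2\<^esup>" "q \<in> [V]\<^bsup>2\<^esup>" "p \<inter> q = {}"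
  shows "card (covering ([V]\<^bsup>4\<^esup>) {p, q}) = 19"
proof -
  have sub: "p \<subseteq> V" "card p = 2" "finite p" "q \<subseteq> V" "card q = 2" "finite q"
    using pq(1,2) unfolding nsets_def by auto
  then have "card (p \<union> q) = 4" using pq(3) by (simp add: card_Un_disjoint)
  then have "card (containing ([V]\<^bsup>4\<^esup>) (p \<union> q)) = 1" using sub V by (subst card_containing) auto
  moreover have "card (containing ([V]\<^bsup>4\<^esup>) r) = 10" if "r \<in> {p, q}" for r
    using that sub V by (subst card_containing) (auto simp: numeral_eq_Suc)
  ultimately show ?thesis
    using card_covering_two[of "[V]\<^bsup>4\<^esup>" p q] V by simp
qed

lemma berge_copy_avoiding_disjoint_pairs_on_7_vertices:
  assumes dist: "distinct [a, b, c, d, e, f, g]"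
  defines "C \<equiv> {a, b, c, d, e, f}" and "Q \<equiv> [{a, b, c, d, e, f, g}]\<^bsup>4\<^esup>" and "B \<equiv> {{a, b}, {c, d}}"
  shows "berge_copy (Q - covering Q B) ([C]\<^bsup>2\<^esup> - B)"
proof (rule berge_copy_if_list)
  let ?L = "[({a, c}, {a, c, e, f}), ({a, d}, {a, d, e, f}), ({b, c}, {b, c, e, f}), ({b, d}, {b, d, e, f}),
    ({a, e}, {a, c, e, g}), ({c, e}, {c, b, e, g}), ({b, e}, {b, d, e, g}), ({d, e}, {d, a, e, g}),
    ({a, f}, {a, c, f, g}), ({c, f}, {c, b, f, g}), ({b, f}, {b, d, f, g}), ({d, f}, {d, a, f, g}),
    ({e, f}, {a, e, f, g})]"
  have dist_rev: "distinct [g, f, e, d, c, b, a]" using dist by auto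
  note neq = dist[simplified] dist_rev[simplified]
  show "distinct (map snd ?L)" by (simp add: set_eq_subset neq)
  have "\<forall>(p, A)\<in>set ?L. A \<in> Q - covering Q B \<and> p \<subseteq> A"
    by (simp add: Q_def B_def nsets_def covering_def neq)
  then show "A \<in> Q - covering Q B \<and> p \<subseteq> A" if "(p, A) \<in> set ?L" for p A
    using that by blast
  show "[C]\<^bsup>2\<^esup> - B \<subseteq> fst ` set ?L"
    by (simp add: C_def B_def nsets_2_insert star_def neq Diff_subset_conv)
qed

lemma card_covering_ge_on_7_vertices:
  assumes V: "finite V" "card V = 7" and C: "C \<in> [V]\<^bsup>6\<^esup>"
    and S: "S \<subseteq> [C]\<^bsup>2\<^esup>" "p \<in> S" "q \<in> S" "p \<inter> q = {}"
  shows "17 + card S \<le> card (covering ([V]\<^bsup>4\<^esup>) S)"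
proof -
  let ?Q = "[V]\<^bsup>4\<^esup>" and ?B = "{p, q}"
  have core: "C \<subseteq> V" "card C = 6" "finite C" "card (V - C) = 1"
    using C V by (auto simp: nsets_def card_Diff_subset)
  have "p \<in> [C]\<^bsup>2\<^esup>" "q \<in> [C]\<^bsup>2\<^esup>" using S by auto
  then obtain a b c d where p: "p = {a, b}" "a \<in> C" "b \<in> C" "a \<noteq> b"
      and q: "q = {c, d}" "c \<in> C" "d \<in> C" "c \<noteq> d"
    by (elim nsets2_E) blast
  have "card (C - {a, b, c, d}) = 2" using p q S(4) core by (subst card_Diff_subset) auto
  then obtain e f where ef: "C - {a, b, c, d} = {e, f}" "e \<noteq> f" by (auto simp: card_2_iff)
  obtain g where g: "V - C = {g}" using core(4) by (auto simp: card_1_singleton_iff)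
  have C_eq: "C = {a, b, c, d, e, f}"
    using Diff_partition[of "{a, b, c, d}" C] p(2,3) q(2,3) unfolding ef(1) by (simp add: insert_commute)
  have V_eq: "V = {a, b, c, d, e, f, g}"
    using Diff_partition[OF core(1)] g unfolding C_eq by (simp add: insert_commute)
  have "g \<notin> C" "e \<notin> {a, b, c, d}" "f \<notin> {a, b, c, d}" using ef(1) g by blast+
  then have "distinct [a, b, c, d, e, f, g]" using p q S(4) ef(2) C_eq by auto
  then have "berge_copy (?Q - covering ?Q ?B) ([C]\<^bsup>2\<^esup> - ?B)"
    using berge_copy_avoiding_disjoint_pairs_on_7_vertices[of a b c d e f g] p(1) q(1)
    by (simp only: C_eq V_eq)
  then have "berge_copy (?Q - covering ?Q ?B) (S - ?B)" by (rule berge_copy_mono) (use S in auto)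
  then have "card (covering ?Q ?B) + card S \<le> card (covering ?Q S) + card ?B"
    using S V by (intro card_covering_ge_if_berge_copy) auto
  moreover have "card (covering ?Q ?B) = 19"
    using S nsets_mono[OF core(1)] by (intro card_covering_disjoint_pairs_on_7_vertices[OF V]) blast+
  moreover have "p \<noteq> q" using p S(4) by blast
  ultimately show ?thesis by simp
qed

lemma card_covering_triangle_on_7_vertices:
  assumes V: "finite V" "card V = 7" and T: "T \<in> [V]\<^bsup>3\<^esup>"
  shows "22 \<le> card (covering ([V]\<^bsup>4\<^esup>) ([T]\<^bsup>2\<^esup>))"
proof -
  obtain a b c where abc: "T = {a, b, c}" "a \<noteq> b" "a \<noteq> c" "b \<noteq> c" "a \<in> V" "b \<in> V" "c \<in> V"
    using T unfolding nsets_def by (auto simp: card_3_iff)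
  let ?S = "covering ([V]\<^bsup>4\<^esup>) (star a {b, c})" and ?R = "containing ([V - {a}]\<^bsup>4\<^esup>) {b, c}"
  have "22 = card ?S + card ?R"
    using card_covering_star[of V a "{b, c}" 3] card_containing[of "V - {a}" "{b, c}" 4] V abc
    by (simp add: numeral_eq_Suc)
  also have "\<dots> = card (?S \<union> ?R)"
    using V by (intro card_Un_disjoint[symmetric])
      (auto simp: covering_star containing_def nsets_def)
  also have "\<dots> \<le> card (covering ([V]\<^bsup>4\<^esup>) ([T]\<^bsup>2\<^esup>))"
  proof (rule card_mono)
    have "star a {b, c} \<subseteq> [T]\<^bsup>2\<^esup>" "{b, c} \<in> [T]\<^bsup>2\<^esup>" using abc by (auto simp: star_def)
    moreover have "[V - {a}]\<^bsup>4\<^esup> \<subseteq> [V]\<^bsup>4\<^esup>" by (rule nsets_mono) blast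
    ultimately show "?S \<union> ?R \<subseteq> covering ([V]\<^bsup>4\<^esup>) ([T]\<^bsup>2\<^esup>)"
      unfolding covering_def containing_def by blast
  qed (use V in simp)
  finally show ?thesis .
qed

lemma star_if_common_vertex:
  assumes "S \<subseteq> [C]\<^bsup>2\<^esup>" "\<And>p. p \<in> S \<Longrightarrow> z \<in> p"
  shows "S = star z {x \<in> C - {z}. {z, x} \<in> S}"
proof (intro equalityI subsetI)
  fix p assume p: "p \<in> S"
  then have "p \<in> [C]\<^bsup>2\<^esup>" using assms(1) by blast
  then obtain x y where "p = {x, y}" "x \<in> C" "y \<in> C" "x \<noteq> y" by (rule nsets2_E)
  moreover have "z \<in> p" using p by (rule assms(2))
  ultimately obtain x where "p = {z, x}" "x \<in> C - {z}" by auto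
  then show "p \<in> star z {x \<in> C - {z}. {z, x} \<in> S}" using p unfolding star_def by blast
qed (auto simp: star_def)

lemma triangle_if_no_common_vertex:
  assumes S: "S \<subseteq> [C]\<^bsup>2\<^esup>" and pairwise: "\<forall>p\<in>S. \<forall>q\<in>S. p \<inter> q \<noteq> {}"
    and no_common: "\<And>z. \<exists>p\<in>S. z \<notin> p"
  obtains T where "T \<in> [C]\<^bsup>3\<^esup>" "S = [T]\<^bsup>2\<^esup>"
proof -
  note intersecting = pairwise[rule_format]
  have pair_with: "\<exists>y\<in>C. p = {x, y} \<and> x \<noteq> y" if "p \<in> S" "x \<in> p" for p x
  proof -
    have "p \<in> [C]\<^bsup>2\<^esup>" using that(1) S by blast
    then obtain u v where "p = {u, v}" "u \<in> C" "v \<in> C" "u \<noteq> v" by (rule nsets2_E)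
    then show ?thesis using that(2) by auto
  qed
  obtain p where p: "p \<in> S" using no_common by blast
  then have "p \<in> [C]\<^bsup>2\<^esup>" using S by blast
  then obtain a b where ab: "p = {a, b}" "a \<in> C" "b \<in> C" "a \<noteq> b" by (rule nsets2_E)
  obtain q r where q: "q \<in> S" "a \<notin> q" and r: "r \<in> S" "b \<notin> r" using no_common by metis
  have "b \<in> q" using intersecting[OF q(1) p] ab(1) q(2) by auto
  then obtain c where c: "q = {b, c}" "c \<in> C" "b \<noteq> c" using pair_with[OF q(1)] by blast
  have "a \<noteq> c" using q(2) c(1) by auto
  have "a \<in> r" "c \<in> r" using intersecting[OF r(1) p] intersecting[OF r(1) q(1)] r(2) ab(1) c(1) by auto
  then have r_eq: "r = {a, c}" using pair_with[OF r(1), of a] \<open>a \<noteq> c\<close> by auto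
  have within: "w \<in> {a, b, c}" if "{w, y} \<in> S" for w y
  proof (rule ccontr)
    assume "w \<notin> {a, b, c}"
    then have "y \<in> p" "y \<in> q" "y \<in> r"
      using intersecting[OF that p] intersecting[OF that q(1)] intersecting[OF that r(1)] ab(1) c(1) r_eq
      by auto
    then show False using ab(1) q(2) r(2) by auto
  qed
  have "S \<subseteq> [{a, b, c}]\<^bsup>2\<^esup>"
  proof
    fix s assume s: "s \<in> S"
    then have "s \<in> [C]\<^bsup>2\<^esup>" using S by blast
    then obtain x y where "s = {x, y}" "x \<noteq> y" by (rule nsets2_E)
    then show "s \<in> [{a, b, c}]\<^bsup>2\<^esup>" using within[of x y] within[of y x] s by (simp add: insert_commute)
  qed
  moreover have "[{a, b, c}]\<^bsup>2\<^esup> \<subseteq> S"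
    using p q(1) r(1) ab c r_eq \<open>a \<noteq> c\<close> by (simp add: nsets_2_insert star_def insert_commute)
  ultimately have "S = [{a, b, c}]\<^bsup>2\<^esup>" by (rule equalityI)
  moreover have "{a, b, c} \<in> [C]\<^bsup>3\<^esup>" using ab c \<open>a \<noteq> c\<close> by (simp add: nsets_def)
  ultimately show thesis by (rule that[rotated])
qed

lemma intersecting_pairs_cases [consumes 3]:
  assumes "S \<subseteq> [C]\<^bsup>2\<^esup>" "S \<noteq> {}" "\<forall>p\<in>S. \<forall>q\<in>S. p \<inter> q \<noteq> {}"
  obtains (star) z X where "z \<in> C" "X \<subseteq> C - {z}" "S = star z X"
  | (triangle) T where "T \<in> [C]\<^bsup>3\<^esup>" "S = [T]\<^bsup>2\<^esup>"
proof (cases "\<exists>z. \<forall>p\<in>S. z \<in> p")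
  case True
  then obtain z where z: "\<And>p. p \<in> S \<Longrightarrow> z \<in> p" by blast
  have "z \<in> C" using z assms(1,2) unfolding nsets_def by blast
  then show ?thesis
  proof (rule star)
    show "S = star z {x \<in> C - {z}. {z, x} \<in> S}" using assms(1) z by (rule star_if_common_vertex)
  qed blast
next
  case False
  then have "\<And>z. \<exists>p\<in>S. z \<notin> p" by blast
  then obtain T where "T \<in> [C]\<^bsup>3\<^esup>" "S = [T]\<^bsup>2\<^esup>"
    using triangle_if_no_common_vertex[OF assms(1,3)] by metis
  then show ?thesis by (rule triangle)
qed

lemma deficient_star_avoiding_vertex_on_7_vertices:
  assumes V: "finite V" "card V = 7" and F: "F \<subseteq> [V]\<^bsup>4\<^esup>" "card ([V]\<^bsup>4\<^esup> - F) \<le> 17"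
    and a: "a \<in> V" and no_copy: "\<not> berge_copy F ([V - {a}]\<^bsup>2\<^esup>)"
  obtains b X where "b \<in> V - {a}" "X \<subseteq> V - {a, b}" "deficient F (star b X)"
proof -
  have fin: "finite ([V]\<^bsup>4\<^esup>)" "finite F" using V(1) F(1) by (simp, rule finite_subset_nsets)
  have bound: "card (covering ([V]\<^bsup>4\<^esup>) S) \<le> card (covering F S) + 17" for S
    using card_covering_le_subfamily[OF fin(1) F(1), of S] F(2) by linarith
  have C: "V - {a} \<in> [V]\<^bsup>6\<^esup>" using V a unfolding nsets_def by auto
  obtain S where S: "S \<subseteq> [V - {a}]\<^bsup>2\<^esup>" "deficient F S"
    using deficient_if_no_berge_copy[OF fin(2) _ no_copy] V(1) by auto
  have "p \<inter> q \<noteq> {}" if "p \<in> S" "q \<in> S" for p q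
    using card_covering_ge_on_7_vertices[OF V C S(1) that] bound[of S] S(2)
    unfolding deficient_def by linarith
  then have "\<forall>p\<in>S. \<forall>q\<in>S. p \<inter> q \<noteq> {}" by blast
  with S(1) deficient_nonempty[OF S(2)] show thesis
  proof (cases rule: intersecting_pairs_cases)
    case (star b X)
    have "X \<subseteq> V - {a, b}" using star(2) by blast
    then show ?thesis using star(1,3) S(2) by (intro that) simp_all
  next
    case (triangle T)
    have "T \<in> [V]\<^bsup>3\<^esup>" using triangle(1) unfolding nsets_def by blast
    then have "22 \<le> card (covering ([V]\<^bsup>4\<^esup>) S)"
      unfolding triangle(2) by (rule card_covering_triangle_on_7_vertices[OF V])
    moreover have "card T = 3" using triangle(1) unfolding nsets_def by blast
    then have "card S = 3" unfolding triangle(2) by (simp add: numeral_eq_Suc)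
    ultimately show ?thesis using bound[of S] S(2) unfolding deficient_def by linarith
  qed
qed

lemma card_eq_1_if_two_deficient_stars_on_7_vertices:
  assumes V: "finite V" "card V = 7" and F: "F \<subseteq> [V]\<^bsup>4\<^esup>" "card ([V]\<^bsup>4\<^esup> - F) \<le> 17"
    and b: "b \<in> V" "X \<subseteq> V - {b}" "card X \<le> 5" "deficient F (star b X)"
    and c: "c \<in> V - {b}" "Y \<subseteq> V - {b, c}" "deficient F (star c Y)"
  shows "card X = 1"
proof (rule ccontr)
  assume "card X \<noteq> 1"
  let ?Q = "[V]\<^bsup>4\<^esup>"
  have fin: "finite ?Q" "finite F" using V(1) F(1) by (simp, rule finite_subset_nsets)
  have card_V: "card (V - {b}) = 6" "card (V - {b, c}) = 5" using V b c by auto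
  then have "card Y \<le> 5" using card_mono[OF _ c(2)] V(1) by simp
  then have "card X \<in> {2, 3, 4, 5}" "card Y \<in> {1, 2, 3, 4, 5}"
    using \<open>card X \<noteq> 1\<close> b(3) card_ge_1_if_deficient_star[OF b(4)] card_ge_1_if_deficient_star[OF c(3)]
    by auto
  let ?S = "covering ?Q (star b X)" and ?T = "covering ([V - {b}]\<^bsup>4\<^esup>) (star c Y)"
  have "card ?S = (6 choose 3) - ((6 - card X) choose 3)"
    using card_covering_star[of V b X 3] V b by simp
  then have "14 + card X \<le> card ?S"
    using \<open>card X \<in> {2, 3, 4, 5}\<close> by (auto simp: numeral_eq_Suc)
  moreover have "card ?T = (5 choose 3) - ((5 - card Y) choose 3)"
    using card_covering_star[of "V - {b}" c Y 3] V card_V b c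
    by (simp add: insert_commute Diff_insert2[symmetric])
  then have "5 + card Y \<le> card ?T"
    using \<open>card Y \<in> {1, 2, 3, 4, 5}\<close> by (auto simp: numeral_eq_Suc)
  moreover have "card (?S \<union> ?T) = card ?S + card ?T"
    using V by (intro card_Un_disjoint) (auto simp: covering_star nsets_def)
  moreover have "card (?S \<union> ?T) \<le> card (covering F (star b X) \<union> covering F (star c Y) \<union> (?Q - F))"
  proof (rule card_mono)
    have "[V - {b}]\<^bsup>4\<^esup> \<subseteq> ?Q" by (rule nsets_mono) blast
    then show "?S \<union> ?T \<subseteq> covering F (star b X) \<union> covering F (star c Y) \<union> (?Q - F)"
      unfolding covering_def by blast
  qed (use fin in simp)
  moreover have "\<dots> \<le> card (covering F (star b X)) + card (covering F (star c Y)) + card (?Q - F)"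
    by (meson add_le_mono1 card_Un_le order_trans)
  ultimately show False using b(4) c(3) F(2) unfolding deficient_def by simp
qed

lemma uncovered_pair_avoiding_vertex_on_7_vertices:
  assumes V: "finite V" "card V = 7" and F: "F \<subseteq> [V]\<^bsup>4\<^esup>" "card ([V]\<^bsup>4\<^esup> - F) \<le> 17"
    and a: "a \<in> V" and no_clique: "\<not> has_berge_clique F V 6"
  obtains p where "p \<in> [V - {a}]\<^bsup>2\<^esup>" "containing F p = {}"
proof -
  have no_copy: "\<not> berge_copy F ([V - {v}]\<^bsup>2\<^esup>)" if "v \<in> V" for v
    using no_clique that V unfolding has_berge_clique_def nsets_def by auto
  obtain b X where b: "b \<in> V - {a}" "X \<subseteq> V - {a, b}" "deficient F (star b X)"
    using deficient_star_avoiding_vertex_on_7_vertices[OF V F a no_copy[OF a]] .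
  have "b \<in> V" using b(1) by blast
  then obtain c Y where c: "c \<in> V - {b}" "Y \<subseteq> V - {b, c}" "deficient F (star c Y)"
    using deficient_star_avoiding_vertex_on_7_vertices[OF V F _ no_copy] by blast
  have "card (V - {a, b}) = 5" using V a b(1) by auto
  then have "card X \<le> 5" using card_mono[OF _ b(2)] V(1) by simp
  moreover have "X \<subseteq> V - {b}" using b(2) by blast
  ultimately have "card X = 1"
    using \<open>b \<in> V\<close> b(3) c by (intro card_eq_1_if_two_deficient_stars_on_7_vertices[OF V F])
  then obtain x where x: "X = {x}" by (auto simp: card_1_singleton_iff)
  show thesis
  proof (rule that)
    show "{b, x} \<in> [V - {a}]\<^bsup>2\<^esup>" using b(1,2) x by auto
    show "containing F {b, x} = {}"
      using b(3) x finite_subset_nsets[OF V(1) F(1)] by (simp add: star_def deficient_singleton)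
  qed
qed

lemma berge_K6_on_7_vertices:
  assumes V: "finite V" "card V = 7" and F: "F \<subseteq> [V]\<^bsup>4\<^esup>" "18 \<le> card F"
  shows "has_berge_clique F V 6"
proof (rule ccontr)
  assume no_clique: "\<not> ?thesis"
  let ?Q = "[V]\<^bsup>4\<^esup>"
  have fin: "finite ?Q" "finite F" using V(1) F(1) by (simp, rule finite_subset_nsets)
  have minority: "card (?Q - F) \<le> 17" using F fin V by (simp add: card_Diff_subset numeral_eq_Suc)
  define M where "M = {p \<in> [V]\<^bsup>2\<^esup>. containing F p = {}}"
  have avoiding: "\<exists>p\<in>M. a \<notin> p" if a: "a \<in> V" for a
  proof -
    obtain p where "p \<in> [V - {a}]\<^bsup>2\<^esup>" "containing F p = {}"
      using uncovered_pair_avoiding_vertex_on_7_vertices[OF V F(1) minority a no_clique] .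
    then show ?thesis unfolding M_def nsets_def by blast
  qed
  have M_bound: "card (covering ?Q S) \<le> 17" if "S \<subseteq> M" for S
    using card_covering_le_if_uncovered[OF fin(1) F(1), of S] that minority unfolding M_def by fastforce
  have "M \<subseteq> [V]\<^bsup>2\<^esup>" unfolding M_def by blast
  moreover have "M \<noteq> {}" using avoiding V(2) by fastforce
  moreover have "\<forall>p\<in>M. \<forall>q\<in>M. p \<inter> q \<noteq> {}"
  proof (intro ballI notI)
    fix p q assume pq: "p \<in> M" "q \<in> M" and "p \<inter> q = {}"
    then have "card (covering ?Q {p, q}) = 19"
      unfolding M_def by (intro card_covering_disjoint_pairs_on_7_vertices[OF V]) auto
    then show False using M_bound[of "{p, q}"] pq by simp
  qed
  ultimately show False
  proof (cases rule: intersecting_pairs_cases)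
    case (star z X)
    then show ?thesis using avoiding[of z] unfolding star_def by blast
  next
    case (triangle T)
    then show ?thesis using card_covering_triangle_on_7_vertices[OF V triangle(1)] M_bound[of M] by simp
  qed
qed

section \<open>Deficient stars\<close>

lemma card_pairs_meeting_ge:
  assumes U: "finite U" "5 \<le> card U" and X: "X \<subseteq> U" "2 \<le> card X"
  shows "card U + card X \<le> card {T \<in> [U]\<^bsup>2\<^esup>. T \<inter> X \<noteq> {}} + 1"
proof -
  have meeting: "card {T \<in> [U]\<^bsup>2\<^esup>. T \<inter> X \<noteq> {}} = (card U choose 2) - ((card U - card X) choose 2)"
    using U(1) X(1) by (rule card_nsets_meeting)
  consider (two) "card X = 2" | (more) "3 \<le> card X" using X(2) by linarith
  then show ?thesis
  proof cases
    case two
    define i where "i = card U - 2"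
    then have "card U = i + 2" using U(2) by simp
    then show ?thesis unfolding meeting two using U(2) by (simp add: numeral_eq_Suc)
  next
    case more
    define i where "i = card U - 3"
    then have i: "card U = i + 3" using U(2) by simp
    have "card X \<le> card U" using U(1) X(1) by (rule card_mono)
    moreover have "(card U - card X) choose 2 \<le> i choose 2"
      using more i by (intro binomial_right_mono) auto
    moreover have "card U choose 2 = (i choose 2) + 3 * i + 3" unfolding i by (simp add: numeral_eq_Suc)
    ultimately show ?thesis unfolding meeting using U(2) i by linarith
  qed
qed

lemma card_pairs_meeting_disjoint_ge:
  assumes "finite U" "X \<subseteq> U" "Y \<subseteq> U" "X \<inter> Y = {}"
  shows "card X * card Y \<le> card {T \<in> [U]\<^bsup>2\<^esup>. T \<inter> X \<noteq> {} \<and> T \<inter> Y \<noteq> {}}"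
proof -
  have "inj_on (\<lambda>(x, y). {x, y}) (X \<times> Y)" using assms(4) by (auto simp: inj_on_def doubleton_eq_iff)
  then have "card X * card Y = card ((\<lambda>(x, y). {x, y}) ` (X \<times> Y))"
    by (simp add: card_image card_cartesian_product)
  also have "\<dots> \<le> card {T \<in> [U]\<^bsup>2\<^esup>. T \<inter> X \<noteq> {} \<and> T \<inter> Y \<noteq> {}}"
    using assms by (intro card_mono) auto
  finally show ?thesis .
qed

lemma card_pairs_meeting_common_point_ge:
  assumes U: "finite U" and XY: "X \<subseteq> U" "Y \<subseteq> U" "2 \<le> card X" "2 \<le> card Y" and z: "X \<inter> Y = {z}"
  shows "card U \<le> card {T \<in> [U]\<^bsup>2\<^esup>. T \<inter> X \<noteq> {} \<and> T \<inter> Y \<noteq> {}}" (is "_ \<le> card ?M")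
proof -
  have "\<not> X \<subseteq> {z}" "\<not> Y \<subseteq> {z}" using XY(3,4) card_mono[of "{z}" X] card_mono[of "{z}" Y] by auto
  then obtain x y where xy: "x \<in> X" "x \<noteq> z" "y \<in> Y" "y \<noteq> z" by blast
  have zxy: "z \<in> X" "z \<in> Y" "x \<noteq> y" using z xy by blast+
  have "{x, y} \<notin> star z (U - {z})" using xy(2,4) by (simp add: star_def image_iff doubleton_eq_iff)
  moreover have "card U = Suc (card (star z (U - {z})))"
    using card_Suc_Diff1[OF U, of z] XY(1) zxy(1) by auto
  ultimately have "card U = card (insert {x, y} (star z (U - {z})))" using U by simp
  moreover have "star z (U - {z}) \<subseteq> ?M" using zxy(1,2) XY(1,2) by (auto simp: star_def)
  moreover have "{x, y} \<in> ?M" using xy(1,3) zxy(3) XY(1,2) by auto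
  ultimately show ?thesis using U by (simp add: card_mono)
qed

lemma card_pairs_meeting_both_ge:
  assumes U: "finite U" "5 \<le> card U" and XY: "X \<subseteq> U" "Y \<subseteq> U" "2 \<le> card X" "2 \<le> card Y"
  shows "card X + card Y \<le> card {T \<in> [U]\<^bsup>2\<^esup>. T \<inter> X \<noteq> {} \<and> T \<inter> Y \<noteq> {}} + 1" (is "_ \<le> card ?M + 1")
proof -
  have fin: "finite X" "finite Y" using U(1) XY finite_subset by blast+
  then have inclusion_exclusion: "card X + card Y = card (X \<union> Y) + card (X \<inter> Y)" by (rule card_Un_Int)
  have Un_bound: "card (X \<union> Y) \<le> card U" using U(1) XY by (intro card_mono) auto
  have "card (X \<inter> Y) = 0 \<or> card (X \<inter> Y) = 1 \<or> 2 \<le> card (X \<inter> Y)" by linarith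
  then consider (disjoint) "X \<inter> Y = {}" | (point) z where "X \<inter> Y = {z}" | (large) "2 \<le> card (X \<inter> Y)"
    using fin by (auto simp: card_1_singleton_iff)
  then show ?thesis
  proof cases
    case disjoint
    define i j where "i = card X - 2" and "j = card Y - 2"
    then have "card X = i + 2" "card Y = j + 2" using XY(3,4) by simp_all
    moreover have "card X * card Y \<le> card ?M"
      using U(1) XY(1,2) disjoint by (rule card_pairs_meeting_disjoint_ge)
    ultimately show ?thesis by (simp add: algebra_simps)
  next
    case (point z)
    then have "card U \<le> card ?M" using U(1) XY by (intro card_pairs_meeting_common_point_ge)
    then show ?thesis using inclusion_exclusion Un_bound point by simp
  next
    case large
    have "card {T \<in> [U]\<^bsup>2\<^esup>. T \<inter> (X \<inter> Y) \<noteq> {}} \<le> card ?M" using U(1) by (intro card_mono) auto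
    moreover have "X \<inter> Y \<subseteq> U" using XY(1) by blast
    ultimately show ?thesis
      using card_pairs_meeting_ge[OF U, of "X \<inter> Y"] large inclusion_exclusion Un_bound by linarith
  qed
qed

text \<open>If \<open>X \<subseteq> insert w U\<close>, then a set \<open>A\<close> that contains \<open>w\<close> and a point of \<open>U\<close> meets \<open>X\<close> iff \<open>A \<inter> U\<close>
  meets \<open>trace U w X\<close>.\<close>

definition trace :: "'a set \<Rightarrow> 'a \<Rightarrow> 'a set \<Rightarrow> 'a set" where
  "trace U w X = (if w \<in> X then U else X)"

lemma trace_subset: "X \<subseteq> insert w U \<Longrightarrow> trace U w X \<subseteq> U"
  unfolding trace_def by auto

lemma card_le_card_trace: "card X \<le> card U \<Longrightarrow> card X \<le> card (trace U w X)"
  unfolding trace_def by simp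

lemma card_trace_ge_2_or_singleton:
  assumes "2 \<le> card U" "1 \<le> card X"
  shows "2 \<le> card (trace U w X) \<or> (\<exists>x. X = {x} \<and> x \<noteq> w)"
proof (cases "w \<in> X \<or> 2 \<le> card X")
  case True
  then show ?thesis using assms(1) unfolding trace_def by auto
next
  case False
  then have "card X = 1" using assms(2) by linarith
  then show ?thesis using False by (auto simp: card_1_singleton_iff)
qed

lemma card_containing_pair_meeting:
  assumes V: "finite V" "v \<in> V" "w \<in> V" "v \<noteq> w" and XY: "v \<notin> X" "w \<notin> Y" and "0 < k"
  defines "U \<equiv> V - {v, w}"
  shows "card {A \<in> containing ([V]\<^bsup>(k + 2)\<^esup>) {v, w}. A \<inter> X \<noteq> {} \<and> A \<inter> Y \<noteq> {}} =
    card {T \<in> [U]\<^bsup>k\<^esup>. T \<inter> trace U w X \<noteq> {} \<and> T \<inter> trace U v Y \<noteq> {}}"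
proof -
  have "k + 2 = card {v, w} + k" using V(4) by simp
  then have "card {A \<in> containing ([V]\<^bsup>(k + 2)\<^esup>) {v, w}. A \<inter> X \<noteq> {} \<and> A \<inter> Y \<noteq> {}} =
      card {T \<in> [U]\<^bsup>k\<^esup>. ({v, w} \<union> T) \<inter> X \<noteq> {} \<and> ({v, w} \<union> T) \<inter> Y \<noteq> {}}"
    unfolding U_def using V by (simp only:) (intro card_containing_filter, auto)
  also have "{T \<in> [U]\<^bsup>k\<^esup>. ({v, w} \<union> T) \<inter> X \<noteq> {} \<and> ({v, w} \<union> T) \<inter> Y \<noteq> {}} =
      {T \<in> [U]\<^bsup>k\<^esup>. T \<inter> trace U w X \<noteq> {} \<and> T \<inter> trace U v Y \<noteq> {}}"
  proof (rule Collect_cong, rule conj_cong[OF refl])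
    fix T assume "T \<in> [U]\<^bsup>k\<^esup>"
    then have "T \<subseteq> U" "T \<noteq> {}" using \<open>0 < k\<close> unfolding nsets_def by auto
    then have "T \<inter> U \<noteq> {}" by blast
    then show "(({v, w} \<union> T) \<inter> X \<noteq> {} \<and> ({v, w} \<union> T) \<inter> Y \<noteq> {}) =
        (T \<inter> trace U w X \<noteq> {} \<and> T \<inter> trace U v Y \<noteq> {})"
      using XY by (auto simp: trace_def)
  qed
  finally show ?thesis .
qed

lemma opposite_deficient_stars_bound:
  assumes V: "finite V" "v \<in> V" "w \<in> V" "v \<noteq> w" and XY: "v \<notin> X" "w \<notin> Y"
    and F: "F \<subseteq> [V]\<^bsup>4\<^esup>" "deficient F (star v X)" "deficient ([V]\<^bsup>4\<^esup> - F) (star w Y)"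
  defines "U \<equiv> V - {v, w}"
  shows "card {T \<in> [U]\<^bsup>2\<^esup>. T \<inter> trace U w X \<noteq> {} \<and> T \<inter> trace U v Y \<noteq> {}} + 2 \<le> card X + card Y"
proof -
  let ?Q = "[V]\<^bsup>4\<^esup>"
  have fin: "finite ?Q" "finite F" using V(1) F(1) by (simp, rule finite_subset_nsets)
  have "card {A \<in> containing ?Q {v, w}. A \<inter> X \<noteq> {} \<and> A \<inter> Y \<noteq> {}} \<le>
      card (covering F (star v X) \<union> covering (?Q - F) (star w Y))"
    using fin by (intro card_mono) (auto simp: covering_star containing_def)
  also have "\<dots> \<le> card (covering F (star v X)) + card (covering (?Q - F) (star w Y))" by (rule card_Un_le)
  finally show ?thesis
    using F(2,3) card_containing_pair_meeting[OF V XY, of 2] unfolding deficient_def U_def by simp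
qed

lemma opposite_deficient_star_if_singleton:
  assumes V: "finite V" "v \<in> V" "w \<in> V" "v \<noteq> w" and x: "x \<in> V - {v, w}"
    and Y: "Y \<subseteq> V - {w}" "card Y \<le> card V - 2"
    and F: "F \<subseteq> [V]\<^bsup>4\<^esup>" "deficient F (star v {x})" "deficient ([V]\<^bsup>4\<^esup> - F) (star w Y)"
  shows "card Y = card V - 2"
proof (rule ccontr)
  assume not_full: "card Y \<noteq> card V - 2"
  let ?U = "V - {v, w}"
  let ?Y = "trace ?U v Y"
  let ?M = "{T \<in> [?U]\<^bsup>2\<^esup>. T \<inter> {x} \<noteq> {} \<and> T \<inter> ?Y \<noteq> {}}"
  have U: "card ?U = card V - 2" using V by (simp add: card_Diff_subset)
  have "trace ?U w {x} = {x}" "w \<notin> Y" using x Y(1) by (auto simp: trace_def)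
  then have M_bound: "card ?M < card Y" using opposite_deficient_stars_bound[OF V _ _ F] x by auto
  have finM: "finite ?M" using V(1) by simp
  have trace_Y: "?Y \<subseteq> ?U" "card Y \<le> card ?Y"
    using trace_subset[of Y v ?U] card_le_card_trace[of Y ?U v] Y U V(2,4) by auto
  show False
  proof (cases "x \<in> ?Y")
    case True
    then have "card (star x (?U - {x})) \<le> card ?M"
      using x finM by (intro card_mono) (auto simp: star_def)
    then show False using M_bound Y(2) not_full U x V(1) by simp
  next
    case False
    then have "card (star x ?Y) \<le> card ?M"
      using x trace_Y(1) finM by (intro card_mono) (auto simp: star_def)
    then show False using M_bound trace_Y(2) by simp
  qed
qed

lemma opposite_deficient_stars:
  assumes V: "finite V" "8 \<le> card V" and vw: "v \<in> V" "w \<in> V" "v \<noteq> w"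
    and X: "X \<subseteq> V - {v}" "card X \<le> card V - 2" and Y: "Y \<subseteq> V - {w}" "card Y \<le> card V - 2"
    and F: "F \<subseteq> [V]\<^bsup>4\<^esup>" "deficient F (star v X)" "deficient ([V]\<^bsup>4\<^esup> - F) (star w Y)"
  obtains (X_singleton) x where "X = {x}" "x \<noteq> w" "card Y = card V - 2"
  | (Y_singleton) y where "Y = {y}" "y \<noteq> v" "card X = card V - 2"
proof -
  let ?U = "V - {v, w}"
  have U: "finite ?U" "card ?U = card V - 2" using V(1) vw by (auto simp: card_Diff_subset)
  have FG: "[V]\<^bsup>4\<^esup> - ([V]\<^bsup>4\<^esup> - F) = F" using F(1) by blast
  have ge: "1 \<le> card X" "1 \<le> card Y" "2 \<le> card ?U"
    using card_ge_1_if_deficient_star[OF F(2)] card_ge_1_if_deficient_star[OF F(3)] U(2) V(2) by simp_all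
  consider (X_small) x where "X = {x}" "x \<noteq> w" | (Y_small) y where "Y = {y}" "y \<noteq> v"
    | (large) "2 \<le> card (trace ?U w X)" "2 \<le> card (trace ?U v Y)"
    using card_trace_ge_2_or_singleton[of ?U X w] card_trace_ge_2_or_singleton[of ?U Y v] ge
    by blast
  then show thesis
  proof cases
    case (X_small x)
    then have "card Y = card V - 2"
      using X(1) F by (intro opposite_deficient_star_if_singleton[OF V(1) vw _ Y]) auto
    then show thesis using X_small by (intro X_singleton)
  next
    case (Y_small y)
    then have "card X = card V - 2"
      using Y(1) F FG vw
      by (intro opposite_deficient_star_if_singleton[OF V(1) vw(2,1) _ _ X, of y "[V]\<^bsup>4\<^esup> - F"]) auto
    then show thesis using Y_small by (intro Y_singleton)
  next
    case large
    have "trace ?U w X \<subseteq> ?U" "trace ?U v Y \<subseteq> ?U" "v \<notin> X" "w \<notin> Y" "5 \<le> card ?U"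
      using X(1) Y(1) U(2) V(2) by (auto simp: trace_def)
    then have "card (trace ?U w X) + card (trace ?U v Y) < card X + card Y"
      using card_pairs_meeting_both_ge[OF U(1) _ _ _ large] opposite_deficient_stars_bound[OF V(1) vw _ _ F]
      by fastforce
    moreover have "card X \<le> card (trace ?U w X)" "card Y \<le> card (trace ?U v Y)"
      using X(2) Y(2) U(2) by (simp_all add: card_le_card_trace)
    ultimately show thesis by linarith
  qed
qed

lemma opposite_center_edges_contain_pair:
  assumes V: "finite V" "4 \<le> card V" and vwx: "v \<in> V" "w \<in> V" "x \<in> V" "v \<noteq> w" "v \<noteq> x" "w \<noteq> x"
    and F: "containing F {v, x} = {}"
    and Y: "Y \<subseteq> V - {w}" "card Y = card V - 2" "deficient ([V]\<^bsup>4\<^esup> - F) (star w Y)"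
    and A: "A \<in> [V]\<^bsup>4\<^esup> - F" "w \<in> A"
  shows "{v, x} \<subseteq> A"
proof -
  let ?Q = "[V]\<^bsup>4\<^esup>"
  have finQ: "finite ?Q" using V(1) by simp
  have meets: "B \<inter> Y \<noteq> {}" if "B \<in> ?Q" "w \<in> B" for B
  proof
    assume "B \<inter> Y = {}"
    then have sub: "B - {w} \<subseteq> V - {w} - Y" using that(1) unfolding nsets_def by blast
    have "card (B - {w}) = 3" using that unfolding nsets_def by simp
    moreover have "card (V - {w} - Y) = 1"
      using Y(1,2) V vwx(2) finite_subset[OF Y(1)] by (simp add: card_Diff_subset)
    ultimately show False using card_mono[OF _ sub] V(1) by simp
  qed
  have "containing ?Q {v, w, x} = covering (?Q - F) (star w Y)"
  proof (rule card_seteq)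
    show "containing ?Q {v, w, x} \<subseteq> covering (?Q - F) (star w Y)"
      using F meets unfolding covering_star containing_def by blast
    have "card (containing ?Q {v, w, x}) = card V - 3"
      using card_containing[OF V(1), of "{v, w, x}" 4] vwx by simp
    then show "card (covering (?Q - F) (star w Y)) \<le> card (containing ?Q {v, w, x})"
      using Y(2,3) unfolding deficient_def by simp
  qed (use finQ in simp)
  moreover have "A \<in> covering (?Q - F) (star w Y)" using A meets unfolding covering_star by blast
  ultimately show ?thesis unfolding containing_def by blast
qed

text \<open>With \<open>R = V - {v, w, x}\<close>, the pairs in \<open>R\<close> are extended by \<open>v\<close> and \<open>w\<close>; the quadruples avoiding
  \<open>v\<close> serve the pairs from \<open>w\<close> to \<open>R\<close> if they avoid \<open>x\<close>, and the pairs at \<open>x\<close> otherwise.\<close>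

lemma berge_copy_edges_at_vertex_avoiding_pair:
  assumes V: "finite V" "8 \<le> card V" and vwx: "v \<in> V" "w \<in> V" "x \<in> V" "v \<noteq> w" "v \<noteq> x" "w \<noteq> x"
  shows "berge_copy {A \<in> [V]\<^bsup>4\<^esup>. w \<in> A \<and> \<not> {v, x} \<subseteq> A} ([V - {v}]\<^bsup>2\<^esup>)"
proof -
  let ?H = "{A \<in> [V]\<^bsup>4\<^esup>. w \<in> A \<and> \<not> {v, x} \<subseteq> A}"
  define R where "R = V - {v, w, x}"
  have "berge_copy (?H \<inter> {A. v \<in> A}) ([R]\<^bsup>2\<^esup>)"
  proof (rule berge_copyI)
    show "inj_on ((\<union>) {v, w}) ([R]\<^bsup>2\<^esup>)" unfolding inj_on_def R_def nsets_def by blast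
    fix p assume "p \<in> [R]\<^bsup>2\<^esup>"
    then have p: "p \<subseteq> V" "v \<notin> p" "w \<notin> p" "x \<notin> p" "finite p" "card p = 2"
      unfolding R_def nsets_def by auto
    then show "{v, w} \<union> p \<in> ?H \<inter> {A. v \<in> A}" using vwx unfolding nsets_def by auto
  qed auto
  moreover have "berge_copy (?H - {A. v \<in> A}) (star w R \<union> star x (insert w R))"
  proof (rule berge_copy_Un)
    have "4 choose 2 \<le> (card V - 4) choose 2" using V(2) by (intro binomial_right_mono) simp
    then have "berge_copy (containing ([V - {v, x}]\<^bsup>Suc 3\<^esup>) {w}) (star w R)"
      using V vwx unfolding R_def by (intro berge_copy_star_containing) (auto simp: numeral_eq_Suc)
    moreover have "containing ([V - {v, x}]\<^bsup>Suc 3\<^esup>) {w} = (?H - {A. v \<in> A}) \<inter> {A. x \<notin> A}"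
      unfolding containing_def nsets_def by auto
    ultimately show "berge_copy ((?H - {A. v \<in> A}) \<inter> {A. x \<notin> A}) (star w R)" by simp
    have "5 choose 2 \<le> (card V - 3) choose 2" using V(2) by (intro binomial_right_mono) simp
    then have "berge_copy (containing ([V - {v}]\<^bsup>Suc 3\<^esup>) {w, x}) (star x (insert w R))"
      using V vwx unfolding R_def
      by (intro berge_copy_star_containing) (auto simp: card_insert_if numeral_eq_Suc)
    moreover have "containing ([V - {v}]\<^bsup>Suc 3\<^esup>) {w, x} = (?H - {A. v \<in> A}) - {A. x \<notin> A}"
      unfolding containing_def nsets_def by auto
    ultimately show "berge_copy ((?H - {A. v \<in> A}) - {A. x \<notin> A}) (star x (insert w R))" by simp
  qed
  ultimately have "berge_copy ?H ([R]\<^bsup>2\<^esup> \<union> (star w R \<union> star x (insert w R)))" by (rule berge_copy_Un)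
  moreover have "V - {v} = insert x (insert w R)" using vwx unfolding R_def by blast
  ultimately show ?thesis using vwx(6) by (simp add: R_def nsets_2_insert Un_assoc)
qed

lemma has_berge_clique_if_opposite_singleton:
  assumes V: "finite V" "8 \<le> card V" and vwx: "v \<in> V" "w \<in> V" "x \<in> V" "v \<noteq> w" "v \<noteq> x" "w \<noteq> x"
    and F: "F \<subseteq> [V]\<^bsup>4\<^esup>" "deficient F (star v {x})"
    and Y: "Y \<subseteq> V - {w}" "card Y = card V - 2" "deficient ([V]\<^bsup>4\<^esup> - F) (star w Y)"
  shows "has_berge_clique F V (card V - 1)"
proof -
  have "finite F" using V(1) F(1) by (rule finite_subset_nsets)
  then have "containing F {v, x} = {}" using F(2) by (simp add: star_def deficient_singleton)
  moreover have "4 \<le> card V" using V(2) by simp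
  ultimately have "{A \<in> [V]\<^bsup>4\<^esup>. w \<in> A \<and> \<not> {v, x} \<subseteq> A} \<subseteq> F"
    using opposite_center_edges_contain_pair[OF V(1) _ vwx _ Y] by blast
  then have "berge_copy F ([V - {v}]\<^bsup>2\<^esup>)"
    using berge_copy_edges_at_vertex_avoiding_pair[OF V vwx] by (auto intro: berge_copy_mono)
  moreover have "V - {v} \<in> [V]\<^bsup>(card V - 1)\<^esup>" using V(1) vwx(1) by (simp add: nsets_def)
  ultimately show ?thesis unfolding has_berge_clique_def by blast
qed

lemma codegree_ge_if_large_trace:
  assumes V: "finite V" "8 \<le> card V" and xy: "x \<in> V" "y \<in> V" "x \<noteq> y"
    and X: "X \<subseteq> V - {x}" "card X \<le> card V - 2" "2 \<le> card (trace (V - {x, y}) y X)"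
    and F: "F \<subseteq> [V]\<^bsup>4\<^esup>" "deficient F (star x X)"
  shows "card V - 2 \<le> card (containing ([V]\<^bsup>4\<^esup> - F) {x, y})"
proof -
  let ?Q = "[V]\<^bsup>4\<^esup>" and ?U = "V - {x, y}" and ?G = "containing ([V]\<^bsup>4\<^esup> - F) {x, y}"
  let ?K = "{A \<in> containing ?Q {x, y}. A \<inter> X \<noteq> {} \<and> A \<inter> {x} \<noteq> {}}"
  have fin: "finite ?Q" "finite F" using V(1) F(1) by (simp, rule finite_subset_nsets)
  have U: "finite ?U" "card ?U = card V - 2" using V(1) xy by (auto simp: card_Diff_subset)
  have "x \<notin> X" using X(1) by blast
  have "trace ?U y X \<subseteq> ?U" "5 \<le> card ?U" using X(1) U(2) V(2) by (auto simp: trace_def)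
  then have "card ?U + card (trace ?U y X) \<le> card {T \<in> [?U]\<^bsup>2\<^esup>. T \<inter> trace ?U y X \<noteq> {}} + 1"
    using X(3) by (intro card_pairs_meeting_ge[OF U(1)])
  moreover have "{T \<in> [?U]\<^bsup>2\<^esup>. T \<inter> trace ?U y X \<noteq> {}} =
      {T \<in> [?U]\<^bsup>2\<^esup>. T \<inter> trace ?U y X \<noteq> {} \<and> T \<inter> trace ?U x {x} \<noteq> {}}"
    by (auto simp: trace_def nsets_2_eq)
  then have "card {T \<in> [?U]\<^bsup>2\<^esup>. T \<inter> trace ?U y X \<noteq> {}} = card ?K"
    using card_containing_pair_meeting[OF V(1) xy \<open>x \<notin> X\<close>, of "{x}" 2] xy(3) by simp
  moreover have "card ?K \<le> card (?G \<union> covering F (star x X))"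
    using fin by (intro card_mono) (auto simp: containing_def covering_star)
  then have "card ?K < card ?G + card X"
    using card_Un_le[of ?G "covering F (star x X)"] F(2) unfolding deficient_def by simp
  moreover have "card X \<le> card (trace ?U y X)" using X(2) U(2) by (simp add: card_le_card_trace)
  ultimately show ?thesis using U(2) by linarith
qed

lemma weighted_codegree_ge_if_uncovered_pair:
  assumes V: "finite V" "4 \<le> card V" and xyz: "x \<in> V" "y \<in> V" "z \<in> V" "x \<noteq> y" "x \<noteq> z" "y \<noteq> z"
    and u: "u \<in> V" "u \<noteq> x" "u \<noteq> y" and F: "containing F {x, z} = {}"
  shows "card V - 2 \<le> (\<Sum>A\<in>containing ([V]\<^bsup>4\<^esup> - F) {x, y}. if u \<in> A then 2 else 1 :: nat)"
    (is "_ \<le> sum ?w ?G")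
proof -
  let ?Q = "[V]\<^bsup>4\<^esup>"
  let ?P = "containing ?Q {x, y, z}"
  have fin: "finite ?Q" using V(1) by simp
  have card_P: "card ?P = card V - 3"
    using card_containing[OF V(1), of "{x, y, z}" 4] xyz by simp
  have "card (containing ?Q {x, y, z, u}) \<noteq> 0"
    using card_containing[OF V(1), of "{x, y, z, u}" 4] xyz u V(2) by (auto simp: card_insert_if)
  then have "containing ?Q {x, y, z, u} \<noteq> {}" by force
  then obtain B where B: "B \<in> ?P" "u \<in> B" unfolding containing_def by auto
  have "card ?P + 1 = ?w B + (\<Sum>A\<in>?P - {B}. 1)" using B fin card_Suc_Diff1[of ?P B] by simp
  also have "\<dots> \<le> ?w B + sum ?w (?P - {B})" by (intro add_left_mono sum_mono) simp
  also have "\<dots> = sum ?w ?P" using B(1) fin by (simp add: sum.remove)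
  also have "\<dots> \<le> sum ?w ?G"
    using F fin by (intro sum_mono2) (auto simp: containing_def)
  finally show ?thesis using card_P V(2) by simp
qed

lemma weighted_codegree_ge_if_deficient_star:
  assumes V: "finite V" "8 \<le> card V" and xyu: "x \<in> V" "y \<in> V" "u \<in> V" "x \<noteq> y" "u \<noteq> x" "u \<noteq> y"
    and X: "X \<subseteq> V - {x}" "card X \<le> card V - 2"
    and F: "F \<subseteq> [V]\<^bsup>4\<^esup>" "deficient F (star x X)"
  shows "card V - 2 \<le> (\<Sum>A\<in>containing ([V]\<^bsup>4\<^esup> - F) {x, y}. if u \<in> A then 2 else 1 :: nat)"
    (is "_ \<le> sum ?w ?G")
proof -
  have "1 \<le> card X" using F(2) by (rule card_ge_1_if_deficient_star)
  moreover have "2 \<le> card (V - {x, y})" using V xyu by (simp add: card_Diff_subset)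
  ultimately consider (large) "2 \<le> card (trace (V - {x, y}) y X)" | (single) z where "X = {z}" "z \<noteq> y"
    using card_trace_ge_2_or_singleton[of "V - {x, y}" X y] by blast
  then show ?thesis
  proof cases
    case large
    then have "card V - 2 \<le> card ?G"
      using xyu X F by (intro codegree_ge_if_large_trace[OF V]) auto
    also have "\<dots> = (\<Sum>A\<in>?G. 1)" by simp
    also have "\<dots> \<le> sum ?w ?G" by (intro sum_mono) simp
    finally show ?thesis .
  next
    case (single z)
    then have "containing F {x, z} = {}"
      using F(2) finite_subset_nsets[OF V(1) F(1)] by (simp add: star_def deficient_singleton)
    then show ?thesis
      using V xyu X(1) single by (intro weighted_codegree_ge_if_uncovered_pair[where z = z]) auto
  qed
qed

section \<open>Extending monochromatic cliques by one vertex\<close>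

definition has_deficient_star :: "'a set \<Rightarrow> 'a set set \<Rightarrow> 'a \<Rightarrow> bool" where
  "has_deficient_star V F v \<longleftrightarrow> (\<exists>X\<subseteq>V - {v}. card X \<le> card V - 2 \<and> deficient F (star v X))"

text \<open>Double counting with weight 2 on the quadruples through \<open>u\<close>: these contain only 3 pairs of the
  core, the others contain 6.\<close>

lemma has_berge_clique_if_all_deficient:
  assumes V: "finite V" "8 \<le> card V" and F: "F \<subseteq> [V]\<^bsup>4\<^esup>"
    and stars: "\<And>v. v \<in> V \<Longrightarrow> has_deficient_star V F v"
  shows "has_berge_clique ([V]\<^bsup>4\<^esup> - F) V (card V - 1)"
proof -
  obtain u where u: "u \<in> V" using V by fastforce
  have "berge_copy ([V]\<^bsup>4\<^esup> - F) ([V - {u}]\<^bsup>2\<^esup>)"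
  proof (rule berge_copy_if_weights[where w = "\<lambda>A. if u \<in> A then 2 else 1"])
    fix p assume "p \<in> [V - {u}]\<^bsup>2\<^esup>"
    then obtain x y where p: "p = {x, y}" "x \<in> V - {u}" "y \<in> V - {u}" "x \<noteq> y" by (rule nsets2_E)
    obtain X where "X \<subseteq> V - {x}" "card X \<le> card V - 2" "deficient F (star x X)"
      using stars[of x] p(2) unfolding has_deficient_star_def by blast
    then have "card V - 2 \<le> (\<Sum>A\<in>containing ([V]\<^bsup>4\<^esup> - F) p. if u \<in> A then 2 else 1 :: nat)"
      unfolding p(1) using p(2-4) u F by (intro weighted_codegree_ge_if_deficient_star[OF V]) auto
    then show "6 \<le> (\<Sum>A\<in>containing ([V]\<^bsup>4\<^esup> - F) p. if u \<in> A then 2 else 1 :: nat)"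
      using V(2) by linarith
  next
    fix A assume "A \<in> [V]\<^bsup>4\<^esup> - F"
    then have A: "A \<subseteq> V" "finite A" "card A = 4" unfolding nsets_def by auto
    then have "{p \<in> [V - {u}]\<^bsup>2\<^esup>. p \<subseteq> A} = [A - {u}]\<^bsup>2\<^esup>" unfolding nsets_def by blast
    then show "(if u \<in> A then 2 else 1) * card {p \<in> [V - {u}]\<^bsup>2\<^esup>. p \<subseteq> A} \<le> 6"
      using A by (simp add: numeral_eq_Suc)
  qed (use V in auto)
  moreover have "V - {u} \<in> [V]\<^bsup>(card V - 1)\<^esup>" using V(1) u by (simp add: nsets_def)
  ultimately show ?thesis unfolding has_berge_clique_def by blast
qed

lemma has_deficient_star_if_clique_not_extending:
  assumes V: "finite V" "2 \<le> card V" "v \<in> V" and F: "finite F"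
    and clique: "has_berge_clique {A \<in> F. v \<notin> A} (V - {v}) (card V - 2)"
    and maximal: "\<not> has_berge_clique F V (card V - 1)"
  shows "has_deficient_star V F v"
proof -
  obtain C where C: "C \<subseteq> V - {v}" "finite C" "card C = card V - 2" "berge_copy {A \<in> F. v \<notin> A} ([C]\<^bsup>2\<^esup>)"
    using clique unfolding has_berge_clique_def nsets_def by blast
  have "card V - 1 = Suc (card V - 2)" using V(2) by simp
  moreover have "v \<notin> C" using C(1) by blast
  ultimately have "insert v C \<in> [V]\<^bsup>(card V - 1)\<^esup>" using C(1-3) V(3) by (auto simp: nsets_def)
  then have "\<not> berge_copy F ([insert v C]\<^bsup>2\<^esup>)" using maximal unfolding has_berge_clique_def by blast
  moreover have "[insert v C]\<^bsup>2\<^esup> = [C]\<^bsup>2\<^esup> \<union> star v C" using C(1) by (intro nsets_2_insert) blast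
  moreover have "berge_copy (F \<inter> {A. v \<notin> A}) ([C]\<^bsup>2\<^esup>)" using C(4) by (simp add: Int_def conj_commute)
  ultimately have "\<not> berge_copy (F - {A. v \<notin> A}) (star v C)" using berge_copy_Un by metis
  then obtain S where S: "S \<subseteq> star v C" "deficient (F - {A. v \<notin> A}) S"
    using deficient_if_no_berge_copy[of "F - {A. v \<notin> A}" "star v C"] F C(2)
    unfolding star_def by blast
  then obtain X where X: "X \<subseteq> C" "S = star v X" unfolding star_def by (meson subset_imageE)
  have "covering (F - {A. v \<notin> A}) S = covering F S" unfolding X(2) covering_star by blast
  then have "deficient F (star v X)" using S(2) X(2) unfolding deficient_def by simp
  moreover have "card X \<le> card V - 2" using card_mono[OF C(2) X(1)] C(3) by simp
  ultimately show ?thesis using X(1) C(1) unfolding has_deficient_star_def by blast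
qed

definition has_monochromatic_berge_clique :: "nat \<Rightarrow> 'a set \<Rightarrow> 'a set set \<Rightarrow> nat \<Rightarrow> bool" where
  "has_monochromatic_berge_clique r V F t \<longleftrightarrow>
     has_berge_clique F V t \<or> has_berge_clique ([V]\<^bsup>r\<^esup> - F) V t"

lemma has_monochromatic_berge_clique_if_opposite_stars:
  assumes V: "finite V" "8 \<le> card V" and vw: "v \<in> V" "w \<in> V" "v \<noteq> w" and F: "F \<subseteq> [V]\<^bsup>4\<^esup>"
    and stars: "has_deficient_star V F v" "has_deficient_star V ([V]\<^bsup>4\<^esup> - F) w"
  shows "has_monochromatic_berge_clique 4 V F (card V - 1)"
proof -
  let ?G = "[V]\<^bsup>4\<^esup> - F"
  obtain X where X: "X \<subseteq> V - {v}" "card X \<le> card V - 2" "deficient F (star v X)"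
    using stars(1) unfolding has_deficient_star_def by blast
  obtain Y where Y: "Y \<subseteq> V - {w}" "card Y \<le> card V - 2" "deficient ?G (star w Y)"
    using stars(2) unfolding has_deficient_star_def by blast
  have FG: "[V]\<^bsup>4\<^esup> - ?G = F" using F by blast
  show ?thesis
    using V vw X(1,2) Y(1,2) F X(3) Y(3)
  proof (cases rule: opposite_deficient_stars)
    case (X_singleton x)
    then have "x \<in> V" "v \<noteq> x" "deficient F (star v {x})" using X by auto
    then have "has_berge_clique F V (card V - 1)"
      using has_berge_clique_if_opposite_singleton[OF V vw(1,2) _ vw(3) _ _ F _ Y(1)] X_singleton(2,3) Y(3)
      by blast
    then show ?thesis unfolding has_monochromatic_berge_clique_def ..
  next
    case (Y_singleton y)
    then have "y \<in> V" "w \<noteq> y" "deficient ?G (star w {y})" using Y by auto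
    then have "has_berge_clique ?G V (card V - 1)"
      using has_berge_clique_if_opposite_singleton[OF V vw(2,1) _ vw(3)[symmetric], of y ?G X]
        Y_singleton(2,3) X(1,3) FG
      by simp
    then show ?thesis unfolding has_monochromatic_berge_clique_def ..
  qed
qed

lemma has_monochromatic_berge_clique_step:
  assumes V: "finite V" "8 \<le> card V" and F: "F \<subseteq> [V]\<^bsup>4\<^esup>"
    and smaller: "\<And>v. v \<in> V \<Longrightarrow>
      has_monochromatic_berge_clique 4 (V - {v}) {A \<in> F. v \<notin> A} (card V - 2)"
  shows "has_monochromatic_berge_clique 4 V F (card V - 1)"
proof (rule ccontr)
  let ?G = "[V]\<^bsup>4\<^esup> - F"
  assume not_mono: "\<not> ?thesis"
  then have none: "\<not> has_berge_clique F V (card V - 1)" "\<not> has_berge_clique ?G V (card V - 1)"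
    unfolding has_monochromatic_berge_clique_def by auto
  have fin: "finite F" "finite ?G" using finite_subset_nsets[OF V(1) F] V(1) by simp_all
  have FG: "[V]\<^bsup>4\<^esup> - ?G = F" using F by blast
  have stars: "has_deficient_star V F v \<or> has_deficient_star V ?G v" if "v \<in> V" for v
  proof -
    have "[V - {v}]\<^bsup>4\<^esup> - {A \<in> F. v \<notin> A} = {A \<in> ?G. v \<notin> A}" unfolding nsets_def by auto
    then have "has_berge_clique {A \<in> F. v \<notin> A} (V - {v}) (card V - 2) \<or>
        has_berge_clique {A \<in> ?G. v \<notin> A} (V - {v}) (card V - 2)"
      using smaller[OF that] unfolding has_monochromatic_berge_clique_def by simp
    then show ?thesis
      using none fin that V by (auto intro: has_deficient_star_if_clique_not_extending)
  qed
  have "\<exists>v\<in>V. \<not> has_deficient_star V F v" "\<exists>v\<in>V. \<not> has_deficient_star V ?G v"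
    using has_berge_clique_if_all_deficient[OF V, of F] has_berge_clique_if_all_deficient[OF V, of ?G]
      none F FG by auto
  then obtain v w where vw: "v \<in> V" "w \<in> V" "has_deficient_star V F v" "has_deficient_star V ?G w"
      "\<not> has_deficient_star V F w"
    using stars by blast
  then have "v \<noteq> w" by blast
  then show False
    using has_monochromatic_berge_clique_if_opposite_stars[OF V vw(1,2) _ F vw(3,4)] not_mono by blast
qed

section \<open>Monochromatic Berge cliques\<close>

lemma berge_K2_if_edge:
  assumes "A \<in> F" "A \<subseteq> V" "2 \<le> card A"
  shows "has_berge_clique F V 2"
proof -
  obtain C where C: "C \<subseteq> A" "card C = 2" using assms(3) by (rule obtain_subset_with_card_n)
  then obtain x y where xy: "C = {x, y}" "x \<noteq> y" by (auto simp: card_2_iff)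
  then have "berge_copy F ([C]\<^bsup>2\<^esup>)"
    using assms(1) C(1) by (intro berge_copyI[of "\<lambda>_. A"]) auto
  moreover have "C \<in> [V]\<^bsup>2\<^esup>" using xy C(1) assms(2) by auto
  ultimately show ?thesis unfolding has_berge_clique_def by blast
qed

lemma berge_K3_on_5_vertices:
  assumes V: "finite V" "card V = 5" and F: "F \<subseteq> [V]\<^bsup>4\<^esup>" "3 \<le> card F"
  shows "has_berge_clique F V 3"
proof -
  define M where "M = {x \<in> V. V - {x} \<in> F}"
  have "F \<subseteq> (\<lambda>x. V - {x}) ` M"
  proof
    fix A assume A: "A \<in> F"
    then have quad: "A \<subseteq> V" "card A = 4" using F(1) unfolding nsets_def by auto
    then have "card (V - A) = 1" using V finite_subset[OF quad(1)] by (simp add: card_Diff_subset)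
    then obtain x where "V - A = {x}" by (auto simp: card_1_singleton_iff)
    then have "A = V - {x}" "x \<in> V" using quad(1) by blast+
    then show "A \<in> (\<lambda>x. V - {x}) ` M" using A unfolding M_def by blast
  qed
  moreover have "finite M" using V(1) unfolding M_def by simp
  ultimately have "3 \<le> card M" using F(2) surj_card_le[of M F] by fastforce
  then obtain C where C: "C \<subseteq> M" "card C = 3" "finite C" by (rule obtain_subset_with_card_n)
  have "berge_copy F ([C]\<^bsup>2\<^esup>)"
  proof (rule berge_copyI)
    show "inj_on ((\<union>) (V - C)) ([C]\<^bsup>2\<^esup>)" unfolding inj_on_def nsets_def by blast
    fix p assume p: "p \<in> [C]\<^bsup>2\<^esup>"
    then have sub: "p \<subseteq> C" "card (C - p) = 1" using C(2) unfolding nsets_def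
      by (auto simp: card_Diff_subset)
    then obtain x where x: "C - p = {x}" by (auto simp: card_1_singleton_iff)
    then have "V - C \<union> p = V - {x}" "x \<in> M" using sub(1) C(1) unfolding M_def by blast+
    then show "V - C \<union> p \<in> F" unfolding M_def by simp
  qed auto
  moreover have "C \<in> [V]\<^bsup>3\<^esup>" using C unfolding M_def nsets_def by auto
  ultimately show ?thesis unfolding has_berge_clique_def by blast
qed

lemma majority:
  assumes "finite Q" "F \<subseteq> Q" "2 * k \<le> Suc (card Q)"
  shows "k \<le> card F \<or> k \<le> card (Q - F)"
proof -
  have "card (Q - F) = card Q - card F" using assms(1,2) by (meson card_Diff_subset finite_subset)
  then show ?thesis using assms(3) by linarith
qed

lemma has_monochromatic_berge_clique_card_Suc:
  assumes "6 \<le> t" "finite V" "card V = Suc t" "F \<subseteq> [V]\<^bsup>4\<^esup>"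
  shows "has_monochromatic_berge_clique 4 V F t"
  using assms
proof (induction t arbitrary: V F rule: nat_induct_at_least)
  case base
  then have "18 \<le> card F \<or> 18 \<le> card ([V]\<^bsup>4\<^esup> - F)"
    by (intro majority) (auto simp: numeral_eq_Suc)
  then show ?case
    unfolding has_monochromatic_berge_clique_def
    using base berge_K6_on_7_vertices[of V F] berge_K6_on_7_vertices[of V "[V]\<^bsup>4\<^esup> - F"] by auto
next
  case (Suc t)
  have "has_monochromatic_berge_clique 4 (V - {v}) {A \<in> F. v \<notin> A} t" if "v \<in> V" for v
  proof (rule Suc.IH)
    show "{A \<in> F. v \<notin> A} \<subseteq> [V - {v}]\<^bsup>4\<^esup>" using Suc.prems(3) unfolding nsets_def by auto
  qed (use that Suc.prems(1,2) in simp_all)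
  then show ?case using has_monochromatic_berge_clique_step[of V F] Suc.prems Suc.hyps by simp
qed

lemma has_monochromatic_berge_clique_card_add_2:
  assumes t: "2 \<le> t" "t \<le> 5" and V: "finite V" "card V = t + 2" and F: "F \<subseteq> [V]\<^bsup>4\<^esup>"
  shows "has_monochromatic_berge_clique 4 V F t"
proof -
  let ?G = "[V]\<^bsup>4\<^esup> - F"
  have fin: "finite ([V]\<^bsup>4\<^esup>)" using V(1) by simp
  have G: "?G \<subseteq> [V]\<^bsup>4\<^esup>" by blast
  consider (five) "t = 5" | (four) "t = 4" | (three) "t = 3" | (two) "t = 2" using t by linarith
  then show ?thesis
  proof cases
    case five
    then have "has_monochromatic_berge_clique 4 V F 6"
      using V F by (intro has_monochromatic_berge_clique_card_Suc) auto
    then show ?thesis using has_berge_clique_antimono[of _ V 6 5]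
      unfolding five has_monochromatic_berge_clique_def by auto
  next
    case four
    then have "8 \<le> card F \<or> 8 \<le> card ?G"
      using V F fin by (intro majority) (auto simp: numeral_eq_Suc)
    then show ?thesis
      using berge_K4_on_6_vertices[OF V(1) _ F] berge_K4_on_6_vertices[OF V(1) _ G] V(2) four
      unfolding has_monochromatic_berge_clique_def by auto
  next
    case three
    then have "3 \<le> card F \<or> 3 \<le> card ?G"
      using V F fin by (intro majority) (auto simp: numeral_eq_Suc)
    then show ?thesis
      using berge_K3_on_5_vertices[OF V(1) _ F] berge_K3_on_5_vertices[OF V(1) _ G] V(2) three
      unfolding has_monochromatic_berge_clique_def by auto
  next
    case two
    then have "V \<in> F \<or> V \<in> ?G" "2 \<le> card V" using V by (auto simp: nsets_def)
    then show ?thesis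
      unfolding two has_monochromatic_berge_clique_def by (meson berge_K2_if_edge order.refl)
  qed
qed

lemma choose_two_le_card_if_berge_clique:
  assumes "finite F" "has_berge_clique F V t"
  shows "t choose 2 \<le> card F"
  using assms card_le_if_berge_copy unfolding has_berge_clique_def nsets_def[of V] by fastforce

lemma no_berge_clique_containing:
  assumes V: "finite V" "card V \<le> Suc t" and p: "p \<in> [V]\<^bsup>2\<^esup>" and t: "2 \<le> t"
  shows "\<not> has_berge_clique (containing ([V]\<^bsup>4\<^esup>) p) V t"
proof
  assume "has_berge_clique (containing ([V]\<^bsup>4\<^esup>) p) V t"
  then have "t choose 2 \<le> card (containing ([V]\<^bsup>4\<^esup>) p)"
    using V(1) by (intro choose_two_le_card_if_berge_clique) simp_all
  also have "\<dots> = (card V - 2) choose 2"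
    using card_containing[OF V(1), of p 4] p by (simp add: nsets_def)
  also have "\<dots> \<le> (t - 1) choose 2" using V(2) by (intro binomial_right_mono) simp
  finally show False using t by (cases t) (simp_all add: numeral_2_eq_2)
qed

lemma no_berge_clique_avoiding:
  assumes V: "finite V" and p: "p \<in> [V]\<^bsup>2\<^esup>"
  shows "\<not> has_berge_clique (F - containing F p) V (card V)"
proof
  assume "has_berge_clique (F - containing F p) V (card V)"
  then obtain C where C: "C \<in> [V]\<^bsup>(card V)\<^esup>" "berge_copy (F - containing F p) ([C]\<^bsup>2\<^esup>)"
    unfolding has_berge_clique_def by blast
  then have "C = V" using V card_subset_eq[of V C] unfolding nsets_def by auto
  then show False using C(2) p unfolding containing_def by (auto elim!: berge_copyE)
qed

lemma no_berge_clique_avoiding_card_Suc: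
  assumes V: "finite V" "card V = Suc t" and p: "p \<in> [V]\<^bsup>2\<^esup>" and t: "2 \<le> t" "t \<le> 5"
  shows "\<not> has_berge_clique ([V]\<^bsup>4\<^esup> - containing ([V]\<^bsup>4\<^esup>) p) V t"
proof
  let ?Q = "[V]\<^bsup>4\<^esup>"
  have fin: "finite ?Q" using V(1) by simp
  have pair: "p \<subseteq> V" "card p = 2" using p unfolding nsets_def by auto
  assume "has_berge_clique (?Q - containing ?Q p) V t"
  then have "t choose 2 \<le> card (?Q - containing ?Q p)"
    using fin by (intro choose_two_le_card_if_berge_clique) simp_all
  also have "\<dots> = card ?Q - card (containing ?Q p)"
    using fin by (intro card_Diff_subset) (auto simp: containing_def)
  also have "\<dots> = (Suc t choose 4) - ((t - 1) choose 2)"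
    using card_containing[OF V(1), of p 4] pair V(2) by simp
  finally have "t choose 2 \<le> (Suc t choose 4) - ((t - 1) choose 2)" .
  moreover have "t \<in> {2, 3, 4, 5}" using t by auto
  ultimately show False by (auto simp: numeral_eq_Suc)
qed

section \<open>Ramsey numbers of Berge families\<close>

lemma verts_complete_hypergraph [simp]: "verts (complete_hypergraph r n) = {..<n}"
  by (simp add: complete_hypergraph_def)

lemma edges_complete_hypergraph [simp]: "edges (complete_hypergraph r n) = [{..<n}]\<^bsup>r\<^esup>"
  by (auto simp: complete_hypergraph_def nsets_def finite_subset)

lemma has_berge_clique_image:
  assumes f: "inj_on f V" and F: "\<And>A. A \<in> F \<Longrightarrow> A \<subseteq> V" and clique: "has_berge_clique F V t"
  shows "has_berge_clique (image f ` F) (f ` V) t"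
proof -
  obtain C where C: "C \<subseteq> V" "finite C" "card C = t" and copy: "berge_copy F ([C]\<^bsup>2\<^esup>)"
    using clique unfolding has_berge_clique_def nsets_def by blast
  obtain \<psi> where \<psi>: "inj_on \<psi> ([C]\<^bsup>2\<^esup>)" "\<And>p. p \<in> [C]\<^bsup>2\<^esup> \<Longrightarrow> \<psi> p \<in> F" "\<And>p. p \<in> [C]\<^bsup>2\<^esup> \<Longrightarrow> p \<subseteq> \<psi> p"
    using copy by (rule berge_copyE) blast
  have "inj_on (image f) (\<psi> ` [C]\<^bsup>2\<^esup>)"
    by (rule inj_on_subset[OF inj_on_image_Pow[OF f]]) (use \<psi>(2) F in blast)
  then have "inj_on (image f \<circ> \<psi>) ([C]\<^bsup>2\<^esup>)" using \<psi>(1) by (intro comp_inj_on)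
  moreover have "(image f \<circ> \<psi>) p \<in> image f ` F \<and> f ` p \<subseteq> (image f \<circ> \<psi>) p" if "p \<in> [C]\<^bsup>2\<^esup>" for p
    using \<psi>(2,3)[OF that] by auto
  moreover have "inj_on f C" "f ` C \<subseteq> f ` V" using f C(1) by (auto intro: inj_on_subset)
  ultimately show ?thesis using C(2,3) by (intro has_berge_clique_if_embedding)
qed

lemma has_berge_clique_if_BK:
  assumes "H \<in> berge r (complete_graph t)"
  shows "has_berge_clique (edges H) (verts H) t"
proof -
  obtain \<phi> \<psi> where \<phi>: "inj_on \<phi> {..<t}" "\<phi> ` {..<t} \<subseteq> verts H"
    and \<psi>: "bij_betw \<psi> ([{..<t}]\<^bsup>2\<^esup>) (edges H)"
    and embeds: "\<And>u v. {u, v} \<in> [{..<t}]\<^bsup>2\<^esup> \<Longrightarrow> {\<phi> u, \<phi> v} \<subseteq> \<psi> {u, v}"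
    using assms unfolding berge_def by auto
  have "\<psi> p \<in> edges H \<and> \<phi> ` p \<subseteq> \<psi> p" if p: "p \<in> [{..<t}]\<^bsup>2\<^esup>" for p
  proof -
    obtain u v where "p = {u, v}" using p by (rule nsets2_E)
    then show ?thesis using embeds[of u v] p bij_betwE[OF \<psi>] by auto
  qed
  then show ?thesis
    using \<phi> bij_betw_imp_inj_on[OF \<psi>] by (intro has_berge_clique_if_embedding) auto
qed

lemma BK_if_has_berge_clique:
  assumes V: "finite V" and F: "F \<subseteq> [V]\<^bsup>r\<^esup>" and clique: "has_berge_clique F V t"
  obtains H where "H \<in> berge r (complete_graph t)" "verts H = V" "edges H \<subseteq> F"
proof -
  obtain C where C: "C \<in> [V]\<^bsup>t\<^esup>" and copy: "berge_copy F ([C]\<^bsup>2\<^esup>)"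
    using clique unfolding has_berge_clique_def by blast
  obtain \<psi> where \<psi>: "inj_on \<psi> ([C]\<^bsup>2\<^esup>)" "\<And>p. p \<in> [C]\<^bsup>2\<^esup> \<Longrightarrow> \<psi> p \<in> F" "\<And>p. p \<in> [C]\<^bsup>2\<^esup> \<Longrightarrow> p \<subseteq> \<psi> p"
    using copy by (rule berge_copyE) blast
  obtain \<phi> where \<phi>: "bij_betw \<phi> {..<t} C"
    using C ex_bij_betw_nat_finite[of C] unfolding nsets_def by (auto simp: atLeast0LessThan)
  define H where "H = \<lparr>verts = V, edges = \<psi> ` [C]\<^bsup>2\<^esup>\<rparr>"
  have bij: "bij_betw (image \<phi>) ([{..<t}]\<^bsup>2\<^esup>) ([C]\<^bsup>2\<^esup>)" using \<phi> by (rule bij_betw_nsets)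
  have "bij_betw (\<lambda>p. \<psi> (\<phi> ` p)) ([{..<t}]\<^bsup>2\<^esup>) (edges H)"
    using bij_betw_trans[OF bij inj_on_imp_bij_betw[OF \<psi>(1)]] by (simp add: H_def comp_def)
  moreover have "{\<phi> u, \<phi> v} \<subseteq> \<psi> (\<phi> ` {u, v})" if "{u, v} \<in> [{..<t}]\<^bsup>2\<^esup>" for u v
    using \<psi>(3)[OF bij_betw_apply[OF bij that]] by simp
  moreover have "inj_on \<phi> {..<t}" "\<phi> ` {..<t} \<subseteq> verts H"
    using \<phi> C unfolding bij_betw_def H_def nsets_def by auto
  moreover have "uniform_hypergraph r H"
    using \<psi>(2) F V unfolding uniform_hypergraph_def H_def nsets_def by auto
  ultimately have "H \<in> berge r (complete_graph t)"
    unfolding berge_def by (auto intro!: exI[of _ \<phi>] exI[of _ "\<lambda>p. \<psi> (\<phi> ` p)"])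
  moreover have "verts H = V" "edges H \<subseteq> F" using \<psi>(2) by (auto simp: H_def)
  ultimately show thesis by (rule that)
qed

lemma hypergraph_iso_sym:
  assumes "hypergraph_iso H H'" "\<And>e. e \<in> edges H \<Longrightarrow> e \<subseteq> verts H"
  shows "hypergraph_iso H' H"
proof -
  obtain f where f: "bij_betw f (verts H) (verts H')" "edges H' = image f ` edges H"
    using assms(1) unfolding hypergraph_iso_def by auto
  let ?g = "inv_into (verts H) f"
  have "?g ` f ` e = e" if "e \<in> edges H" for e
    using inv_into_image_cancel[OF bij_betw_imp_inj_on[OF f(1)] assms(2)[OF that]] .
  then have "edges H = image ?g ` edges H'" unfolding f(2) by (simp add: image_image)
  then show ?thesis using bij_betw_inv_into[OF f(1)] unfolding hypergraph_iso_def by blast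
qed

definition color_class :: "nat \<Rightarrow> nat \<Rightarrow> (nat set \<Rightarrow> bool) \<Rightarrow> bool \<Rightarrow> nat set set" where
  "color_class r N c b = {A \<in> [{..<N}]\<^bsup>r\<^esup>. c A = b}"

lemma has_colored_copy_BK_iff:
  "has_colored_copy r N c b (BK r t) \<longleftrightarrow> has_berge_clique (color_class r N c b) {..<N} t"
proof
  assume "has_colored_copy r N c b (BK r t)"
  then obtain H' H where H': "subhypergraph H' (complete_hypergraph r N)" "\<forall>e\<in>edges H'. c e = b"
    and H: "H \<in> BK r t" and iso: "hypergraph_iso H' H"
    unfolding has_colored_copy_def by blast
  have "hypergraph_iso H H'"
    using iso by (rule hypergraph_iso_sym) (use H'(1) in \<open>simp add: subhypergraph_def\<close>)
  then obtain g where g: "bij_betw g (verts H) (verts H')" "edges H' = image g ` edges H"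
    unfolding hypergraph_iso_def by auto
  have "uniform_hypergraph r H" using H unfolding berge_def by blast
  then have "\<And>e. e \<in> edges H \<Longrightarrow> e \<subseteq> verts H" unfolding uniform_hypergraph_def by blast
  then have "has_berge_clique (image g ` edges H) (g ` verts H) t"
    using has_berge_clique_if_BK[OF H] bij_betw_imp_inj_on[OF g(1)] by (intro has_berge_clique_image)
  then have "has_berge_clique (edges H') (verts H') t"
    using g(2) bij_betw_imp_surj_on[OF g(1)] by simp
  moreover have "verts H' \<subseteq> {..<N}" "edges H' \<subseteq> color_class r N c b"
    using H' by (auto simp: subhypergraph_def color_class_def)
  ultimately show "has_berge_clique (color_class r N c b) {..<N} t" by (rule has_berge_clique_mono)
next
  assume clique: "has_berge_clique (color_class r N c b) {..<N} t"
  have "color_class r N c b \<subseteq> [{..<N}]\<^bsup>r\<^esup>" unfolding color_class_def by blast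
  from BK_if_has_berge_clique[OF finite_lessThan this clique]
  obtain H :: "nat hypergraph" where H: "H \<in> BK r t" "verts H = {..<N}" "edges H \<subseteq> color_class r N c b" .
  have edges_H: "edges H \<subseteq> [{..<N}]\<^bsup>r\<^esup>" "\<forall>e\<in>edges H. c e = b"
    using H(3) unfolding color_class_def by auto
  then have "subhypergraph H (complete_hypergraph r N)"
    using H(2) by (auto simp: subhypergraph_def nsets_def)
  moreover have "hypergraph_iso H H" unfolding hypergraph_iso_def by (auto intro!: exI[of _ id])
  ultimately show "has_colored_copy r N c b (BK r t)"
    using H(1) edges_H(2) unfolding has_colored_copy_def by blast
qed

lemma has_colored_copy_mono:
  assumes "has_colored_copy r M c b \<F>" "M \<le> N"
  shows "has_colored_copy r N c b \<F>"
proof -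
  have "[{..<M}]\<^bsup>r\<^esup> \<subseteq> [{..<N}]\<^bsup>r\<^esup>" using assms(2) by (intro nsets_mono) simp
  then have "subhypergraph H (complete_hypergraph r N)" if "subhypergraph H (complete_hypergraph r M)" for H
    using that assms(2) unfolding subhypergraph_def by fastforce
  then show ?thesis using assms(1) unfolding has_colored_copy_def by blast
qed

lemma ramsey_number_eqI:
  assumes upper: "\<And>c. has_colored_copy r (Suc n) c True \<F>\<^sub>1 \<or> has_colored_copy r (Suc n) c False \<F>\<^sub>2"
    and lower: "\<not> has_colored_copy r n c True \<F>\<^sub>1" "\<not> has_colored_copy r n c False \<F>\<^sub>2"
  shows "ramsey_number r \<F>\<^sub>1 \<F>\<^sub>2 = enat (Suc n)"
proof -
  have "enat (Suc n) \<le> enat N"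
    if "\<forall>c. has_colored_copy r N c True \<F>\<^sub>1 \<or> has_colored_copy r N c False \<F>\<^sub>2" for N
    using that lower has_colored_copy_mono[of r N _ _ _ n] by (metis enat_ord_simps(1) not_less_eq_eq)
  then show ?thesis
    unfolding ramsey_number_def using upper by (intro antisym Inf_lower Inf_greatest) auto
qed

lemma ramsey_number_BK_eqI:
  assumes upper: "\<And>F. F \<subseteq> [{..<Suc n}]\<^bsup>r\<^esup> \<Longrightarrow> has_monochromatic_berge_clique r {..<Suc n} F t"
    and lower: "\<not> has_berge_clique (containing ([{..<n}]\<^bsup>r\<^esup>) p) {..<n} t"
      "\<not> has_berge_clique ([{..<n}]\<^bsup>r\<^esup> - containing ([{..<n}]\<^bsup>r\<^esup>) p) {..<n} t"
  shows "ramsey_number r (BK r t) (BK r t) = enat (Suc n)"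
proof (rule ramsey_number_eqI)
  fix c :: "nat set \<Rightarrow> bool"
  have "color_class r (Suc n) c False = [{..<Suc n}]\<^bsup>r\<^esup> - color_class r (Suc n) c True"
    "color_class r (Suc n) c True \<subseteq> [{..<Suc n}]\<^bsup>r\<^esup>"
    unfolding color_class_def by auto
  then show "has_colored_copy r (Suc n) c True (BK r t) \<or> has_colored_copy r (Suc n) c False (BK r t)"
    using upper[of "color_class r (Suc n) c True"]
    unfolding has_colored_copy_BK_iff has_monochromatic_berge_clique_def by simp
next
  have "color_class r n ((\<subseteq>) p) True = containing ([{..<n}]\<^bsup>r\<^esup>) p"
    "color_class r n ((\<subseteq>) p) False = [{..<n}]\<^bsup>r\<^esup> - containing ([{..<n}]\<^bsup>r\<^esup>) p"
    unfolding color_class_def containing_def by auto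
  then show "\<not> has_colored_copy r n ((\<subseteq>) p) True (BK r t)" "\<not> has_colored_copy r n ((\<subseteq>) p) False (BK r t)"
    using lower unfolding has_colored_copy_BK_iff by simp_all
qed

theorem theorem1p6:
  "(\<forall>t::nat. 2 \<le> t \<and> t \<le> 5 \<longrightarrow> ramsey_number 4 (BK 4 t) (BK 4 t) = enat (t + 2)) \<and>
   (\<forall>t::nat. 6 \<le> t \<longrightarrow> ramsey_number 4 (BK 4 t) (BK 4 t) = enat (t + 1))"
proof (intro conjI allI impI)
  fix t :: nat assume t: "2 \<le> t \<and> t \<le> 5"
  then have "{0, 1} \<in> [{..<Suc t}]\<^bsup>2\<^esup>" by simp
  then have "ramsey_number 4 (BK 4 t) (BK 4 t) = enat (Suc (Suc t))"
    using t by (intro ramsey_number_BK_eqI[where p = "{0, 1}"] has_monochromatic_berge_clique_card_add_2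
      no_berge_clique_containing no_berge_clique_avoiding_card_Suc) auto
  then show "ramsey_number 4 (BK 4 t) (BK 4 t) = enat (t + 2)" by simp
next
  fix t :: nat assume t: "6 \<le> t"
  then have "{0, 1} \<in> [{..<t}]\<^bsup>2\<^esup>" by simp
  moreover from this have "\<not> has_berge_clique ([{..<t}]\<^bsup>4\<^esup> - containing ([{..<t}]\<^bsup>4\<^esup>) {0, 1}) {..<t} t"
    using no_berge_clique_avoiding[of "{..<t}"] by simp
  ultimately have "ramsey_number 4 (BK 4 t) (BK 4 t) = enat (Suc t)"
    using t by (intro ramsey_number_BK_eqI[where p = "{0, 1}"] has_monochromatic_berge_clique_card_Suc
      no_berge_clique_containing) auto
  then show "ramsey_number 4 (BK 4 t) (BK 4 t) = enat (t + 1)" by simp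
qed

end
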